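(* Let $p=(p_1,\ldots,p_n)\in\mathbb D^n$, and write $p_j=r_je^{i\beta_j}$ with $0<r_j<1$ whenever $p_j\ne0$. Let $F=(f_1,\ldots,f_n):\mathbb D\to\mathbb D^n$ be harmonic with $F(0)=p$. If $$\|dF_0\|=\left(\sum_{j=1}^n\mathcal M(|p_j|)^2\right)^{1/2},$$ then there is $\alpha\in\mathbb R$ such that, for each $j$, the radial boundary function $\Phi_j$ of $f_j$ satisfies, almost everywhere on $\mathbb T$, $$\Phi_j(e^{it})=e^{i\beta_j}\frac{\lambda(r_j)+i\sigma_j\cos(t-\alpha)}{\sqrt{\lambda(r_j)^2+\cos^2(t-\alpha)}}\quad\text{for some }\sigma_j\in\{-1,1\},\qquad\text{if }p_j\neq0,$$ $$\Phi_j(e^{it})=\omega_j\,\operatorname{sgn}(\cos(t-\alpha))\quad\text{for some }\omega_j\in\mathbb T,\qquad\text{if }p_j=0.$$ Conversely, for every $\alpha\in\mathbb R$, $\sigma_j\in\{-1,1\}$ and $\omega_j\in\mathbb T$, the map whose components are the Poisson integrals of these boundary functions is a harmonic map $\mathbb D\to\mathbb D^n$ taking the value $p$ at $0$ and attaining the displayed equality. In particular, every such extremal map has radial boundary values in $\mathbb T^n$ almost everywhere.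
   Context: $\mathbb D=\{z\in\mathbb C:|z|<1\}$, $\mathbb T=\partial\mathbb D$. Harmonic maps into $\mathbb C^n\simeq\mathbb R^{2n}$ are understood componentwise. $\|dF_0\|$ is the operator norm of the real differential $dF_0:\mathbb R^2\to\mathbb R^{2n}$ for the Euclidean norms. A bounded harmonic function on $\mathbb D$ has radial boundary values almost everywhere on $\mathbb T$ and is their Poisson integral. The function $\mathcal M:[0,1)\to(0,\infty)$ is given by $\mathcal M(0)=4/\pi$ and, for $0<r<1$, $$\mathcal M(r)=2\int_0^{2\pi}\frac{\cos^2t}{\sqrt{\lambda(r)^2+\cos^2t}}\,\frac{dt}{2\pi},$$ where $\lambda(r)>0$ is the unique positive solution of $$r=\int_0^{2\pi}\frac{\lambda(r)}{\sqrt{\lambda(r)^2+\cos^2t}}\,\frac{dt}{2\pi}.$$ *)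

theory Defs
  imports "HOL-Analysis.Analysis"
begin

abbreviation unit_disc :: "complex set" where
  "unit_disc \<equiv> ball 0 1"

(* Harmonic on an open set: C^2 with vanishing Laplacian.  ux, uy are the first partial
   derivatives with respect to Re z and Im z, and uxx, uxy, uyx, uyy the second ones.  For
   complex-valued f this is the same as harmonicity of Re f and Im f. *)
definition harmonic_on :: "(complex \<Rightarrow> 'a::real_normed_vector) \<Rightarrow> complex set \<Rightarrow> bool" where
  "harmonic_on u S \<longleftrightarrow> open S \<and>
     (\<exists>ux uy uxx uxy uyx uyy.
        (\<forall>z\<in>S. (u has_derivative (\<lambda>h. Re h *\<^sub>R ux z + Im h *\<^sub>R uy z)) (at z) \<and>
               (ux has_derivative (\<lambda>h. Re h *\<^sub>R uxx z + Im h *\<^sub>R uxy z)) (at z) \<and>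
               (uy has_derivative (\<lambda>h. Re h *\<^sub>R uyx z + Im h *\<^sub>R uyy z)) (at z) \<and>
               uxx z + uyy z = 0) \<and>
        continuous_on S uxx \<and> continuous_on S uxy \<and>
        continuous_on S uyx \<and> continuous_on S uyy)"

definition harmonic_polydisc_map :: "(complex \<Rightarrow> complex ^ 'n) \<Rightarrow> bool" where
  "harmonic_polydisc_map F \<longleftrightarrow>
     (\<forall>j. harmonic_on (\<lambda>z. F z $ j) unit_disc) \<and>
     (\<forall>z\<in>unit_disc. \<forall>j. F z $ j \<in> unit_disc)"

definition lam :: "real \<Rightarrow> real" where
  "lam r = (THE l. l > 0 \<and>
     r = (LINT t:{0..2*pi}|lborel. l / sqrt (l\<^sup>2 + (cos t)\<^sup>2)) / (2*pi))"

definition MM :: "real \<Rightarrow> real" where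
  "MM r = (if r = 0 then 4 / pi
           else 2 * ((LINT t:{0..2*pi}|lborel. (cos t)\<^sup>2 / sqrt ((lam r)\<^sup>2 + (cos t)\<^sup>2)) / (2*pi)))"

(* Boundary functions on the unit circle are represented by functions of the angle t. *)

definition has_radial_limit :: "(complex \<Rightarrow> complex) \<Rightarrow> real \<Rightarrow> complex \<Rightarrow> bool" where
  "has_radial_limit f t w \<longleftrightarrow> ((\<lambda>\<rho>. f (of_real \<rho> * cis t)) \<longlongrightarrow> w) (at_left 1)"

definition poisson_integral :: "(real \<Rightarrow> complex) \<Rightarrow> complex \<Rightarrow> complex" where
  "poisson_integral \<phi> z =
     (LINT t:{0..2*pi}|lborel. of_real ((1 - (cmod z)\<^sup>2) / (cmod (cis t - z))\<^sup>2) * \<phi> t)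
       / of_real (2*pi)"

definition bdry_nonzero :: "real \<Rightarrow> real \<Rightarrow> real \<Rightarrow> real \<Rightarrow> real \<Rightarrow> complex" where
  "bdry_nonzero r \<beta> \<sigma> \<alpha> t =
     cis \<beta> * (of_real (lam r) + \<i> * of_real (\<sigma> * cos (t - \<alpha>)))
       / of_real (sqrt ((lam r)\<^sup>2 + (cos (t - \<alpha>))\<^sup>2))"

definition bdry_zero :: "complex \<Rightarrow> real \<Rightarrow> real \<Rightarrow> complex" where
  "bdry_zero \<omega> \<alpha> t = \<omega> * of_real (sgn (cos (t - \<alpha>)))"

(* The norm on complex ^ 'n is the Euclidean one, and frechet_derivative is the real differential. *)
definition extremal_at :: "complex ^ 'n \<Rightarrow> (complex \<Rightarrow> complex ^ 'n) \<Rightarrow> bool" where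
  "extremal_at p F \<longleftrightarrow>
     harmonic_polydisc_map F \<and> F 0 = p \<and>
     onorm (frechet_derivative F (at 0)) = sqrt (\<Sum>j\<in>UNIV. (MM (cmod (p $ j)))\<^sup>2)"

end

theory Submission
  imports Defs "HOL-Complex_Analysis.Cauchy_Integral_Formula"
begin

text \<open>
  Choose a direction $e^{i\alpha}$ in which the differential at 0 attains its norm. Each component
  is then extremal by itself, so it suffices to treat one harmonic $f$ with $|f| \le 1$,
  $f(0) = rc$ and $df_0(e^{i\alpha}) = du$, where $|c| = |u| = 1$ and $d \ge 0$. With
  $\lambda = \lambda(r)$ ($\lambda = 0$ if $r = 0$) put $w(t) = \lambda c + u \cos(t-\alpha)$ and
  $s(t) = \sqrt{\lambda^2 + \cos^2(t-\alpha)}$. For $\rho < 1$ the means over the circle satisfy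
  \[ \lambda r + \rho d/2 = \int \mathrm{Re}(f(\rho e^{it}) \overline{w(t)})
      \le \int |w| \le \int s = \lambda r + M(r)/2. \]
  The last inequality is $|w| \le s + (|w|^2 - s^2)/(2s)$, whose correction term changes sign
  under $t \mapsto t + \pi$ and so integrates to 0. If $d = M(r)$, the second inequality forces $u \perp c$
  when $\lambda > 0$, and the first one forces $f(\rho e^{it}) \to w(t)/|w(t)|$ almost everywhere
  along a sequence $\rho \to 1$. Hence $f$ is the Poisson integral of the explicit function $w/|w|$,
  and its radial limits follow from the continuity of that function; Fatou's theorem is not needed.
\<close>

section \<open>Normalised Lebesgue measure on the circle\<close>

text \<open>The function w is a Lagrange multiplier. The derivative of a Poisson integral at 0 in
  direction \<alpha> is twice the moment of its boundary function \<phi> against cos (t - \<alpha>).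
  Maximising it under |\<phi>| \<le> 1 with prescribed mean r c means maximising the integral of Re
  (\<phi> * cnj w), and sgn w does this pointwise. If u is orthogonal to c, then |w| = s, and the
  equation defining \<lambda> says exactly that sgn w has mean r c. For other u the mean of |w| has
  no such simple value. The bound used instead is the tangent line of the square root at s^2, so its
  loss is a square divided by 2 s; this lets one multiplier serve every u. The components separate
  because \<alpha> is common to all of them: |df_j(e^{i\<alpha>})| \<le> M(|p_j|) for each j, and
  equal sums of squares force equality in every term. For the converse, mean and moment of the
  explicit functions are computed, and the same upper bound controls the directions other than
  \<alpha>.\<close>

definition circ :: "real measure" where
  "circ = density lborel (\<lambda>t. ennreal (indicator {0..2*pi} t / (2*pi)))"

lemma sets_circ [measurable_cong, simp]: "sets circ = sets borel"
  by (simp add: circ_def)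

lemma space_circ [simp]: "space circ = UNIV"
  by (simp add: circ_def)

lemma borel_measurable_circ [simp]: "borel_measurable circ = borel_measurable borel"
  by (rule measurable_cong_sets) simp_all

text \<open>Bridge to the set integrals in \<open>lam\<close>, \<open>MM\<close> and
  \<open>poisson_integral\<close>. With the normalisation inside a measure of mass 1, the arguments
  below are about plain Bochner integrals.\<close>

lemma integral_circ:
  fixes f :: "real \<Rightarrow> 'b::{banach, second_countable_topology}"
  assumes "f \<in> borel_measurable borel"
  shows "integral\<^sup>L circ f = (LINT t:{0..2*pi}|lborel. f t) /\<^sub>R (2*pi)"
proof -
  have "integral\<^sup>L circ f = (LINT t|lborel. (indicator {0..2*pi} t / (2*pi)) *\<^sub>R f t)"
    unfolding circ_def
  proof (rule integral_density)
    show "AE t in lborel. 0 \<le> indicat_real {0..2*pi} t / (2*pi)"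
      by (rule AE_I2) (simp add: indicator_def)
  qed (use assms in simp_all)
  also have "\<dots> = (LINT t|lborel. inverse (2*pi) *\<^sub>R (indicator {0..2*pi} t *\<^sub>R f t))"
    by (rule Bochner_Integration.integral_cong) (simp_all add: field_simps)
  also have "\<dots> = inverse (2*pi) *\<^sub>R (LINT t|lborel. indicator {0..2*pi} t *\<^sub>R f t)"
    by (rule integral_scaleR_right)
  finally show ?thesis
    unfolding set_lebesgue_integral_def .
qed

lemma integral_circ_real:
  fixes f :: "real \<Rightarrow> real"
  assumes "f \<in> borel_measurable borel"
  shows "(LINT t:{0..2*pi}|lborel. f t) / (2*pi) = integral\<^sup>L circ f"
  using integral_circ[OF assms] by (simp add: field_simps)

lemma integral_circ_complex:
  fixes f :: "real \<Rightarrow> complex"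
  assumes "f \<in> borel_measurable borel"
  shows "(LINT t:{0..2*pi}|lborel. f t) / of_real (2*pi) = integral\<^sup>L circ f"
  using integral_circ[OF assms] by (simp add: scaleR_conv_of_real field_simps)

lemma AE_circ: "AE t in lborel. P t \<Longrightarrow> AE t in circ. P t"
  unfolding circ_def by (subst AE_density) (auto elim: eventually_mono)

lemma emeasure_circ: "emeasure circ UNIV = 1"
proof -
  have "emeasure circ UNIV = (\<integral>\<^sup>+t. ennreal (1/(2*pi)) * indicator {0..2*pi} t \<partial>lborel)"
    unfolding circ_def by (subst emeasure_density) (auto intro!: nn_integral_cong split: split_indicator)
  also have "\<dots> = ennreal (1/(2*pi)) * ennreal (2*pi)"
    by (subst nn_integral_cmult_indicator) auto
  also have "\<dots> = 1"
    by (subst ennreal_mult[symmetric]) auto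
  finally show ?thesis .
qed

interpretation circ: finite_measure circ
  by (rule finite_measureI) (simp add: emeasure_circ)

lemma measure_circ [simp]: "measure circ UNIV = 1"
  by (simp add: measure_def emeasure_circ)

lemma integrable_circ:
  fixes f :: "real \<Rightarrow> 'b::{banach, second_countable_topology}"
  assumes "f \<in> borel_measurable borel" "\<And>t. norm (f t) \<le> B"
  shows "integrable circ f"
  using assms by (intro circ.integrable_const_bound[where B = B]) auto

lemma AE_circ_False: "\<not> (AE t in circ. False)"
  using ae_filter_eq_bot_iff[of circ] by (simp add: emeasure_circ eventually_False)

text \<open>The exceptional angles of the final radial limits all come from this countable set; for
  r = 0 the extremal boundary function jumps there.\<close>

lemma AE_cos_nonzero:
  fixes \<alpha> :: real
  shows "AE t in lborel. cos (t - \<alpha>) \<noteq> 0"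
proof -
  have "{t. cos (t - \<alpha>) = 0} \<subseteq> range (\<lambda>i::int. \<alpha> + of_int i * (pi/2))"
  proof
    fix t assume "t \<in> {t. cos (t - \<alpha>) = 0}"
    then obtain i :: int where "t - \<alpha> = of_int i * (pi/2)" by (auto simp: cos_zero_iff_int)
    then have "t = \<alpha> + of_int i * (pi/2)" by simp
    then show "t \<in> range (\<lambda>i::int. \<alpha> + of_int i * (pi/2))" by blast
  qed
  then have "countable {t. cos (t - \<alpha>) = 0}"
    by (rule countable_subset) simp
  then show ?thesis
    using AE_not_in[OF countable_imp_null_set_lborel, of "{t. cos (t - \<alpha>) = 0}"] by simp
qed

text \<open>With an antiderivative \<open>G\<close>, the integral over the period starting at a is
  \<open>G (2*pi + a) - G a\<close>. By periodicity of g this has derivative 0 in a.\<close>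

lemma integral_circ_shift:
  fixes g :: "real \<Rightarrow> real"
  assumes cont: "continuous_on UNIV g" and per: "\<And>t. g (t + 2*pi) = g t"
  shows "integral\<^sup>L circ (\<lambda>t. g (t - \<alpha>)) = integral\<^sup>L circ g"
proof -
  \<comment> \<open>Large enough that every period starting in [-|\<alpha>|, |\<alpha>|] lies in
    [-R, R].\<close>
  define R where "R = \<bar>\<alpha>\<bar> + 2*pi"
  have "continuous_on {-R..R} g" using cont continuous_on_subset by blast
  then obtain G where G: "\<And>x. x \<in> {-R..R} \<Longrightarrow> (G has_vector_derivative g x) (at x within {-R..R})"
    using antiderivative_continuous by blast
  have HK: "integral\<^sup>L circ (\<lambda>t. g (t - a)) = (G (2*pi - a) - G (- a)) / (2*pi)"
    if "\<bar>a\<bar> \<le> \<bar>\<alpha>\<bar>" for a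
  proof -
    have c: "continuous_on A (\<lambda>t. g (t - a))" for A
      by (rule continuous_on_compose2[OF cont]) (auto intro!: continuous_intros)
    have m: "(\<lambda>t. g (t - a)) \<in> borel_measurable borel"
      by (rule borel_measurable_continuous_onI[OF c])
    have "((\<lambda>t. g (t - a)) has_integral ((\<lambda>t. G (t - a)) (2*pi) - (\<lambda>t. G (t - a)) 0)) {0..2*pi}"
    proof (rule fundamental_theorem_of_calculus)
      fix x assume x: "x \<in> {0..2*pi}"
      have "((\<lambda>t. t - a) has_vector_derivative 1) (at x within {0..2*pi})"
        by (auto intro!: derivative_eq_intros)
      moreover have "(G has_vector_derivative g (x - a)) (at (x - a) within (\<lambda>t. t - a) ` {0..2*pi})"
        by (rule has_vector_derivative_within_subset[OF G]) (use that x in \<open>auto simp: R_def\<close>)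
      ultimately show "((\<lambda>t. G (t - a)) has_vector_derivative g (x - a)) (at x within {0..2*pi})"
        using vector_diff_chain_within[of "\<lambda>t. t - a" 1 x "{0..2*pi}" G "g (x - a)"]
        by (simp add: o_def)
    qed auto
    moreover have "set_integrable lborel {0..2*pi} (\<lambda>t. g (t - a))"
      unfolding set_integrable_def by (rule borel_integrable_compact) (auto intro: c)
    ultimately have "(LINT t:{0..2*pi}|lborel. g (t - a)) = G (2*pi - a) - G (- a)"
      by (simp add: set_borel_integral_eq_integral(2) integral_unique)
    then show ?thesis
      using integral_circ_real[OF m] by simp
  qed
  have shift: "G (2*pi - a) - G (- a) = G (2*pi) - G 0" if a: "a \<in> {-\<bar>\<alpha>\<bar>..\<bar>\<alpha>\<bar>}" for a
  proof -
    let ?S = "{-\<bar>\<alpha>\<bar>..\<bar>\<alpha>\<bar>}"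
    have "\<exists>c. \<forall>a\<in>?S. G (2*pi + a) - G a = c"
    proof (rule has_derivative_zero_constant)
      fix x assume x: "x \<in> ?S"
      have "-R \<le> 2*pi + y" if "- \<bar>\<alpha>\<bar> \<le> y" for y
        using that pi_gt_zero unfolding R_def by linarith
      then have "(G has_vector_derivative g (2*pi + x)) (at (2*pi + x) within (\<lambda>t. 2*pi + t) ` ?S)"
        by (intro has_vector_derivative_within_subset[OF G]) (use x in \<open>auto simp: R_def\<close>)
      moreover have "((\<lambda>t. 2*pi + t) has_vector_derivative 1) (at x within ?S)"
        by (auto intro!: derivative_eq_intros)
      ultimately have 1: "((\<lambda>t. G (2*pi + t)) has_vector_derivative g (2*pi + x)) (at x within ?S)"
        using vector_diff_chain_within[of "\<lambda>t. 2*pi + t" 1 x ?S G "g (2*pi + x)"] by (simp add: o_def)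
      have 2: "(G has_vector_derivative g x) (at x within ?S)"
        by (rule has_vector_derivative_within_subset[OF G]) (use x pi_gt_zero in \<open>auto simp: R_def intro: order_trans[of _ "\<bar>\<alpha>\<bar>"] order_trans[of _ "-\<bar>\<alpha>\<bar>"]\<close>)
      have "((\<lambda>a. G (2*pi + a) - G a) has_vector_derivative (g (2*pi + x) - g x)) (at x within ?S)"
        by (rule has_vector_derivative_diff[OF 1 2])
      then show "((\<lambda>a. G (2*pi + a) - G a) has_derivative (\<lambda>h. 0)) (at x within ?S)"
        by (simp add: per add.commute[of "2*pi"] has_vector_derivative_def)
    qed simp
    then obtain c where c: "\<And>a. a \<in> ?S \<Longrightarrow> G (2*pi + a) - G a = c" by blast
    show ?thesis using c[of "-a"] c[of 0] a by simp
  qed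
  have "G (2*pi - \<alpha>) - G (- \<alpha>) = G (2*pi) - G 0"
    by (rule shift) (auto simp: abs_le_iff)
  with HK[OF order_refl] HK[of 0] show ?thesis by simp
qed

text \<open>The second half period, translated by pi, cancels the first. Measurability instead of
  continuity is assumed because the kernel cos / s, to which this is applied, is the discontinuous
  sign of the cosine when \<lambda> = 0.\<close>

lemma integral_circ_antiperiodic:
  fixes h :: "real \<Rightarrow> real"
  assumes m: "h \<in> borel_measurable borel" and b: "\<And>t. \<bar>h t\<bar> \<le> B"
    and anti: "\<And>t. h (t + pi) = - h t"
  shows "integral\<^sup>L circ h = 0"
proof -
  have int: "set_integrable lborel {c..d} h" for c d
  proof -
    have "integrable lborel (\<lambda>t. indicator {c..d} t *\<^sub>R B)"
      by (rule borel_integrable_compact) auto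
    then show ?thesis unfolding set_integrable_def
    proof (rule Bochner_Integration.integrable_bound)
      show "AE t in lborel. norm (indicator {c..d} t *\<^sub>R h t) \<le> norm (indicator {c..d} t *\<^sub>R B)"
      proof (rule AE_I2)
        fix t
        have "\<bar>h t\<bar> \<le> \<bar>B\<bar>" using b[of t] by linarith
        then show "norm (indicator {c..d} t *\<^sub>R h t) \<le> norm (indicator {c..d} t *\<^sub>R B)"
          by (simp add: indicator_def)
      qed
    qed (use m in measurable)
  qed
  have "(LINT t:{0..2*pi}|lborel. h t) = (LINT t:{0..pi}\<union>{pi<..2*pi}|lborel. h t)"
    by (simp add: ivl_disj_un_two(8)[of 0 pi "2*pi", symmetric])
  also have "\<dots> = (LINT t:{0..pi}|lborel. h t) + (LINT t:{pi<..2*pi}|lborel. h t)"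
    by (intro set_integral_Un int set_integrable_subset[OF int[of pi "2*pi"]]) auto
  also have "(LINT t:{pi<..2*pi}|lborel. h t) = (LINT t|lborel. indicator {pi<..2*pi} (pi + t) *\<^sub>R h (pi + t))"
    unfolding set_lebesgue_integral_def
    using lborel_integral_real_affine[of 1 "\<lambda>t. indicator {pi<..2*pi} t *\<^sub>R h t" pi] by simp
  also have "\<dots> = (LINT t|lborel. indicator {0<..pi} t *\<^sub>R - h t)"
    by (rule Bochner_Integration.integral_cong) (auto simp: anti add.commute[of pi] indicator_def)
  also have "\<dots> = (LINT t|lborel. indicator {0..pi} t *\<^sub>R - h t)"
  proof (rule integral_cong_AE)
    show "AE t in lborel. indicator {0<..pi} t *\<^sub>R - h t = indicator {0..pi} t *\<^sub>R - h t"
      using AE_lborel_singleton[of 0] by eventually_elim (simp add: indicator_def)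
  qed (use m in measurable)
  also have "\<dots> = - (LINT t:{0..pi}|lborel. h t)"
    by (simp add: set_lebesgue_integral_def)
  finally have "(LINT t:{0..2*pi}|lborel. h t) = 0"
    by simp
  then show ?thesis
    using integral_circ_real[OF m] by simp
qed

section \<open>The functions \<open>lam\<close> and \<open>MM\<close>\<close>

text \<open>Includes l = c = 0, where the quotient is 0. With the roles of l and c exchanged it also
  bounds the kernel cos / s.\<close>

lemma lam_kernel_le_1: "\<bar>l / sqrt (l\<^sup>2 + c\<^sup>2)\<bar> \<le> (1::real)"
proof (cases "sqrt (l\<^sup>2 + c\<^sup>2) = 0")
  case False
  have "\<bar>l\<bar> \<le> sqrt (l\<^sup>2 + c\<^sup>2)" by (rule real_le_rsqrt) (simp add: power2_eq_square)
  moreover have "sqrt (l\<^sup>2 + c\<^sup>2) > 0" using False by (simp add: less_le)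
  ultimately show ?thesis by simp
qed (metis abs_0 div_by_0 zero_le_one)

lemma integrable_lam_kernel: "integrable circ (\<lambda>t. l / sqrt (l\<^sup>2 + (cos t)\<^sup>2))"
  by (rule integrable_circ[where B = 1]) (use lam_kernel_le_1 in auto)

text \<open>The endpoint 0 is included because the intermediate value argument for
  \<open>lam_exists\<close> starts there. At l = 0 the integrand is continuous in l only where cos t
  is nonzero, hence dominated convergence with an almost everywhere limit.\<close>

lemma continuous_on_lam_kernel_integral:
  "continuous_on {0..} (\<lambda>l. integral\<^sup>L circ (\<lambda>t. l / sqrt (l\<^sup>2 + (cos t)\<^sup>2)))"
  unfolding continuous_on_sequentially o_def
proof (intro allI ballI impI, elim conjE)
  fix x :: "nat \<Rightarrow> real" and a assume lim: "x \<longlonglongrightarrow> a"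
  show "(\<lambda>n. integral\<^sup>L circ (\<lambda>t. x n / sqrt ((x n)\<^sup>2 + (cos t)\<^sup>2)))
          \<longlonglongrightarrow> integral\<^sup>L circ (\<lambda>t. a / sqrt (a\<^sup>2 + (cos t)\<^sup>2))"
  proof (rule integral_dominated_convergence[where w = "\<lambda>_. 1"])
    show "AE t in circ. (\<lambda>n. x n / sqrt ((x n)\<^sup>2 + (cos t)\<^sup>2)) \<longlonglongrightarrow> a / sqrt (a\<^sup>2 + (cos t)\<^sup>2)"
      using AE_circ[OF AE_cos_nonzero[of 0]]
    proof eventually_elim
      case (elim t)
      then have "sqrt (a\<^sup>2 + (cos t)\<^sup>2) \<noteq> 0" by (simp add: add_nonneg_eq_0_iff)
      then show ?case by (intro tendsto_intros lim)
    qed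
    show "AE t in circ. norm (x n / sqrt ((x n)\<^sup>2 + (cos t)\<^sup>2)) \<le> 1" for n
      using lam_kernel_le_1 by auto
  qed simp_all
qed

lemma lam_kernel_strict_mono:
  fixes c :: real
  assumes "0 < l" "l < m" "c \<noteq> 0"
  shows "l / sqrt (l\<^sup>2 + c\<^sup>2) < m / sqrt (m\<^sup>2 + c\<^sup>2)"
proof -
  have "l\<^sup>2 < m\<^sup>2" using assms by (intro power_strict_mono) auto
  then have "l\<^sup>2 * (m\<^sup>2 + c\<^sup>2) < m\<^sup>2 * (l\<^sup>2 + c\<^sup>2)"
    using assms by (simp add: algebra_simps)
  then have "(l * sqrt (m\<^sup>2 + c\<^sup>2))\<^sup>2 < (m * sqrt (l\<^sup>2 + c\<^sup>2))\<^sup>2"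
    by (simp add: power_mult_distrib)
  then have "l * sqrt (m\<^sup>2 + c\<^sup>2) < m * sqrt (l\<^sup>2 + c\<^sup>2)"
    by (rule power2_less_imp_less) (use assms in auto)
  moreover have "sqrt (l\<^sup>2 + c\<^sup>2) > 0" "sqrt (m\<^sup>2 + c\<^sup>2) > 0"
    using assms by (auto intro: add_nonneg_pos)
  ultimately show ?thesis by (simp add: divide_simps)
qed

lemma lam_kernel_integral_strict_mono:
  assumes "0 < l" "l < m"
  shows "integral\<^sup>L circ (\<lambda>t. l / sqrt (l\<^sup>2 + (cos t)\<^sup>2)) < integral\<^sup>L circ (\<lambda>t. m / sqrt (m\<^sup>2 + (cos t)\<^sup>2))"
proof -
  have less: "AE t in circ. l / sqrt (l\<^sup>2 + (cos t)\<^sup>2) < m / sqrt (m\<^sup>2 + (cos t)\<^sup>2)"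
    using AE_circ[OF AE_cos_nonzero[of 0]]
    by eventually_elim (use lam_kernel_strict_mono[OF assms] in auto)
  show ?thesis
    by (rule circ.integral_less_AE_space[OF integrable_lam_kernel integrable_lam_kernel less])
      (simp add: emeasure_circ)
qed

lemma lam_exists:
  assumes "0 < r" "r < 1"
  shows "\<exists>l>0. integral\<^sup>L circ (\<lambda>t. l / sqrt (l\<^sup>2 + (cos t)\<^sup>2)) = r"
proof -
  let ?G = "\<lambda>l. integral\<^sup>L circ (\<lambda>t. l / sqrt (l\<^sup>2 + (cos t)\<^sup>2))"
  \<comment> \<open>The solution of b / sqrt (b^2 + 1) = r. Since cos^2 \<le> 1, the kernel at
    \<open>b\<close> is at least r pointwise.\<close>
  define b where "b = r / sqrt (1 - r\<^sup>2)"
  have r2: "r\<^sup>2 < 1" using assms by (simp add: power_less_one_iff)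
  have b: "b > 0" using assms r2 by (simp add: b_def)
  have b2: "b\<^sup>2 + 1 = 1 / (1 - r\<^sup>2)" using r2 by (simp add: b_def power_divide field_simps)
  have "r \<le> b / sqrt (b\<^sup>2 + (cos t)\<^sup>2)" for t
  proof -
    have "sqrt (b\<^sup>2 + (cos t)\<^sup>2) \<le> sqrt (b\<^sup>2 + 1)" by (simp add: abs_square_le_1)
    also have "\<dots> = 1 / sqrt (1 - r\<^sup>2)" by (simp add: b2 real_sqrt_divide)
    finally have "b / (1 / sqrt (1 - r\<^sup>2)) \<le> b / sqrt (b\<^sup>2 + (cos t)\<^sup>2)"
      using b by (intro divide_left_mono) (auto intro!: divide_pos_pos add_pos_nonneg simp: r2)
    then show ?thesis using r2 by (simp add: b_def)
  qed
  then have "integral\<^sup>L circ (\<lambda>t. r) \<le> ?G b"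
    by (intro integral_mono integrable_lam_kernel) auto
  then have "\<exists>l. 0 \<le> l \<and> l \<le> b \<and> ?G l = r"
    using assms b by (intro IVT' continuous_on_subset[OF continuous_on_lam_kernel_integral]) auto
  then obtain l where "0 \<le> l" "?G l = r" by blast
  moreover from this have "l \<noteq> 0" using assms by (intro notI) simp
  ultimately show ?thesis by (metis order_le_less)
qed

lemma lam_pos_integral:
  assumes "0 < r" "r < 1"
  shows "lam r > 0 \<and> integral\<^sup>L circ (\<lambda>t. lam r / sqrt ((lam r)\<^sup>2 + (cos t)\<^sup>2)) = r"
proof -
  let ?P = "\<lambda>l. l > 0 \<and> r = (LINT t:{0..2*pi}|lborel. l / sqrt (l\<^sup>2 + (cos t)\<^sup>2)) / (2*pi)"
  have P: "?P l \<longleftrightarrow> l > 0 \<and> integral\<^sup>L circ (\<lambda>t. l / sqrt (l\<^sup>2 + (cos t)\<^sup>2)) = r" for l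
    by (subst integral_circ_real) auto
  have "\<exists>!l. ?P l"
    unfolding P using lam_exists[OF assms] lam_kernel_integral_strict_mono
    by (metis less_irrefl linorder_neqE_linordered_idom)
  from theI'[OF this] have "?P (lam r)"
    unfolding lam_def[symmetric] .
  then show ?thesis unfolding P .
qed

text \<open>Twice this mean is the separately defined value 4 / pi of \<open>MM\<close> at 0, so the
  integral formula with \<lambda> = 0 covers that case.\<close>

lemma abs_cos_integral: "integral\<^sup>L circ (\<lambda>t. \<bar>cos t\<bar>) = 2 / pi"
proof -
  have A: "((\<lambda>t. \<bar>cos t\<bar>) has_integral (sin (pi/2) - sin 0)) {0..pi/2}"
  proof (rule fundamental_theorem_of_calculus)
    fix x assume "x \<in> {0..pi/2}"
    then have "\<bar>cos x\<bar> = cos x" using cos_ge_zero[of x] by auto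
    then show "(sin has_vector_derivative \<bar>cos x\<bar>) (at x within {0..pi/2})"
      by (auto intro!: derivative_eq_intros simp flip: has_real_derivative_iff_has_vector_derivative)
  qed simp
  have B: "((\<lambda>t. \<bar>cos t\<bar>) has_integral ((\<lambda>x. - sin x) (3*pi/2) - (\<lambda>x. - sin x) (pi/2))) {pi/2..3*pi/2}"
  proof (rule fundamental_theorem_of_calculus)
    fix x assume "x \<in> {pi/2..3*pi/2}"
    then have "cos (x - pi) \<ge> 0" by (intro cos_ge_zero) auto
    then have "\<bar>cos x\<bar> = - cos x" by simp
    then show "((\<lambda>x. - sin x) has_vector_derivative \<bar>cos x\<bar>) (at x within {pi/2..3*pi/2})"
      by (auto intro!: derivative_eq_intros simp flip: has_real_derivative_iff_has_vector_derivative)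
  qed simp
  have C: "((\<lambda>t. \<bar>cos t\<bar>) has_integral (sin (2*pi) - sin (3*pi/2))) {3*pi/2..2*pi}"
  proof (rule fundamental_theorem_of_calculus)
    fix x assume "x \<in> {3*pi/2..2*pi}"
    then have "cos (x - 2*pi) \<ge> 0" by (intro cos_ge_zero) auto
    then have "\<bar>cos x\<bar> = cos x" by (simp add: cos_diff)
    then show "(sin has_vector_derivative \<bar>cos x\<bar>) (at x within {3*pi/2..2*pi})"
      by (auto intro!: derivative_eq_intros simp flip: has_real_derivative_iff_has_vector_derivative)
  qed simp
  have s: "sin (3*pi/2) = -1" using sin_periodic_pi[of "pi/2"] by (simp add: field_simps)
  have "((\<lambda>t. \<bar>cos t\<bar>) has_integral 4) {0..2*pi}"
    using has_integral_combine[OF _ _ has_integral_combine[OF _ _ A B] C] by (simp add: s)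
  moreover have "set_integrable lborel {0..2*pi} (\<lambda>t. \<bar>cos t\<bar>)"
    unfolding set_integrable_def by (rule borel_integrable_compact) (auto intro!: continuous_intros)
  ultimately have "(LINT t:{0..2*pi}|lborel. \<bar>cos t\<bar>) = 4"
    by (simp add: set_borel_integral_eq_integral(2) integral_unique)
  moreover have "(LINT t:{0..2*pi}|lborel. \<bar>cos t\<bar>) / (2*pi) = integral\<^sup>L circ (\<lambda>t. \<bar>cos t\<bar>)"
    by (rule integral_circ_real) simp
  ultimately show ?thesis by simp
qed

text \<open>The equation defining \<open>lam r\<close> has no positive solution at \<open>r = 0\<close>, where \<open>lam\<close> is unspecified;
  its limit value 0 makes the formulas
  for \<open>r = 0\<close> and \<open>r > 0\<close> agree.\<close>

definition lam0 :: "real \<Rightarrow> real" where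
  "lam0 r = (if r = 0 then 0 else lam r)"

lemma lam0_integral:
  "0 \<le> r \<Longrightarrow> r < 1 \<Longrightarrow> integral\<^sup>L circ (\<lambda>t. lam0 r / sqrt ((lam0 r)\<^sup>2 + (cos t)\<^sup>2)) = r"
  using lam_pos_integral[of r] by (auto simp: lam0_def)

lemma MM_eq: "MM r = 2 * integral\<^sup>L circ (\<lambda>t. (cos t)\<^sup>2 / sqrt ((lam0 r)\<^sup>2 + (cos t)\<^sup>2))"
proof (cases "r = 0")
  case True
  have "(cos t)\<^sup>2 / sqrt ((cos t)\<^sup>2) = \<bar>cos t\<bar>" for t :: real
    using real_div_sqrt[of "(cos t)\<^sup>2"] by simp
  with True show ?thesis
    by (simp add: MM_def lam0_def abs_cos_integral)
next
  case False
  then show ?thesis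
    unfolding MM_def lam0_def by (subst integral_circ_real) auto
qed

lemma cos_kernel_le_1: "\<bar>(cos t)\<^sup>2 / sqrt (l\<^sup>2 + (cos t)\<^sup>2)\<bar> \<le> (1::real)"
proof -
  have "\<bar>cos t\<bar> * \<bar>cos t / sqrt ((cos t)\<^sup>2 + l\<^sup>2)\<bar> \<le> 1 * 1"
    by (intro mult_mono lam_kernel_le_1) auto
  then show ?thesis by (simp add: power2_eq_square abs_mult add.commute)
qed

lemma MM_nonneg: "MM r \<ge> 0"
  unfolding MM_eq by (intro mult_nonneg_nonneg Bochner_Integration.integral_nonneg) auto

text \<open>Write s = s^2 / s = \<lambda> * (\<lambda> / s) + cos^2 / s, valid also where s = 0. The
  first mean is r by the choice of \<lambda>, the second is half of \<open>MM r\<close>.\<close>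

lemma sqrt_lam0_integral:
  assumes "0 \<le> r" "r < 1"
  shows "integral\<^sup>L circ (\<lambda>t. sqrt ((lam0 r)\<^sup>2 + (cos t)\<^sup>2)) = lam0 r * r + MM r / 2"
proof -
  let ?A = "\<lambda>t. (lam0 r)\<^sup>2 + (cos t)\<^sup>2"
  have "sqrt (?A t) = lam0 r * (lam0 r / sqrt (?A t)) + (cos t)\<^sup>2 / sqrt (?A t)" for t
    using real_div_sqrt[of "?A t"] by (simp add: add_divide_distrib power2_eq_square)
  then have "integral\<^sup>L circ (\<lambda>t. sqrt (?A t)) =
      integral\<^sup>L circ (\<lambda>t. lam0 r * (lam0 r / sqrt (?A t)) + (cos t)\<^sup>2 / sqrt (?A t))" by presburger
  also have "\<dots> = integral\<^sup>L circ (\<lambda>t. lam0 r * (lam0 r / sqrt (?A t))) + integral\<^sup>L circ (\<lambda>t. (cos t)\<^sup>2 / sqrt (?A t))"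
  proof (rule Bochner_Integration.integral_add)
    show "integrable circ (\<lambda>t. (cos t)\<^sup>2 / sqrt (?A t))"
      by (rule integrable_circ[where B = 1]) (use cos_kernel_le_1 in auto)
  qed (intro integrable_mult_right integrable_lam_kernel)
  also have "\<dots> = lam0 r * r + MM r / 2"
    using lam0_integral[OF assms] by (simp only: integral_mult_right_zero MM_eq)
  finally show ?thesis .
qed

section \<open>Harmonic functions and the Poisson formula\<close>

lemma has_real_derivative_along_line:
  fixes g :: "complex \<Rightarrow> real"
  assumes "(g has_derivative D) (at (p + of_real x * e))"
  shows "((\<lambda>x. g (p + of_real x * e)) has_real_derivative D e) (at x)"
proof -
  have "((\<lambda>x. p + of_real x * e) has_derivative (\<lambda>h. of_real h * e)) (at x)"
    by (auto intro!: derivative_eq_intros)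
  from has_derivative_compose[OF this assms]
  have "((\<lambda>x. g (p + of_real x * e)) has_derivative (\<lambda>h. D (h *\<^sub>R e))) (at x)"
    by (simp add: scaleR_conv_of_real)
  moreover have "(\<lambda>h. D (h *\<^sub>R e)) = (*) (D e)"
    using has_derivative_linear[OF assms] by (auto simp: linear_scale)
  ultimately show ?thesis by (simp add: has_field_derivative_def)
qed

text \<open>The mean value theorem is applied along e to the increment of g in e', then along e' to
  the derivative of g in e. The second difference is symmetric in e and e', so exchanging them
  compares the two orders of differentiation.\<close>

lemma second_difference_mean_value:
  fixes g :: "complex \<Rightarrow> real"
  assumes g: "\<And>z. z \<in> ball z0 d \<Longrightarrow> (g has_derivative D z) (at z)"
    and D: "\<And>z. z \<in> ball z0 d \<Longrightarrow> ((\<lambda>z. D z e) has_derivative E z) (at z)"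
    and e: "norm e = 1" "norm e' = 1" and s: "0 < s" "2 * s < d"
  obtains w where "norm (w - z0) \<le> 2 * s"
    "g (z0 + of_real s * e + of_real s * e') - g (z0 + of_real s * e) - g (z0 + of_real s * e') + g z0
       = s\<^sup>2 * E w e'"
proof -
  have in_ball: "z0 + of_real a * e + of_real b * e' \<in> ball z0 d \<and>
      norm (z0 + of_real a * e + of_real b * e' - z0) \<le> 2 * s"
    if "0 \<le> a" "a \<le> s" "0 \<le> b" "b \<le> s" for a b
  proof -
    have "norm (of_real a * e + of_real b * e') \<le> a + b"
      using norm_triangle_ineq[of "of_real a * e" "of_real b * e'"] that e by (simp add: norm_mult)
    moreover have "z0 + of_real a * e + of_real b * e' - z0 = of_real a * e + of_real b * e'" by simp
    moreover have "dist z0 (z0 + of_real a * e + of_real b * e') = norm (of_real a * e + of_real b * e')"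
      by (metis add.assoc add_diff_cancel_left' dist_commute dist_norm)
    ultimately show ?thesis using that s by simp
  qed
  let ?\<phi> = "\<lambda>x. g (z0 + of_real s * e' + of_real x * e) - g (z0 + of_real x * e)"
  have "\<exists>x>0. x < s \<and> ?\<phi> s - ?\<phi> 0 = (s - 0) *
      (D (z0 + of_real s * e' + of_real x * e) e - D (z0 + of_real x * e) e)"
  proof (rule MVT2)
    fix x assume x: "0 \<le> x" "x \<le> s"
    show "(?\<phi> has_real_derivative
        (D (z0 + of_real s * e' + of_real x * e) e - D (z0 + of_real x * e) e)) (at x)"
      using in_ball[of x s] in_ball[of x 0] x s
      by (intro DERIV_diff has_real_derivative_along_line g) (auto simp: add_ac)
  qed (use s in auto)
  then obtain x where x: "0 < x" "x < s" and
    1: "?\<phi> s - ?\<phi> 0 = s * (D (z0 + of_real s * e' + of_real x * e) e - D (z0 + of_real x * e) e)"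
    by auto
  let ?\<psi> = "\<lambda>y. D (z0 + of_real x * e + of_real y * e') e"
  have "\<exists>y>0. y < s \<and> ?\<psi> s - ?\<psi> 0 = (s - 0) * E (z0 + of_real x * e + of_real y * e') e'"
  proof (rule MVT2)
    fix y assume y: "0 \<le> y" "y \<le> s"
    show "(?\<psi> has_real_derivative E (z0 + of_real x * e + of_real y * e') e') (at y)"
      using in_ball[of x y] x y by (intro has_real_derivative_along_line D) auto
  qed (use s in auto)
  then obtain y where y: "0 < y" "y < s"
    and 2: "?\<psi> s - ?\<psi> 0 = s * E (z0 + of_real x * e + of_real y * e') e'" by auto
  show ?thesis
  proof (rule that)
    show "norm (z0 + of_real x * e + of_real y * e' - z0) \<le> 2 * s"
      using in_ball[of x y] x y by simp
    show "g (z0 + of_real s * e + of_real s * e') - g (z0 + of_real s * e) - g (z0 + of_real s * e') + g z0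
       = s\<^sup>2 * E (z0 + of_real x * e + of_real y * e') e'"
      using 1 2 by (simp add: power2_eq_square add_ac)
  qed
qed

text \<open>\<open>harmonic_on\<close> lists \<open>uxy\<close> and \<open>uyx\<close> separately
  and asks only for their continuity, so their equality has to be derived. The values are real
  because the mean value theorem is; real and imaginary parts are treated in turn.\<close>

lemma mixed_partials_eq_real:
  fixes g :: "complex \<Rightarrow> real"
  assumes S: "open S" "z0 \<in> S"
    and g: "\<And>z. z \<in> S \<Longrightarrow> (g has_derivative (\<lambda>h. Re h * gx z + Im h * gy z)) (at z)"
    and gx: "\<And>z. z \<in> S \<Longrightarrow> (gx has_derivative (\<lambda>h. Re h * gxx z + Im h * gxy z)) (at z)"
    and gy: "\<And>z. z \<in> S \<Longrightarrow> (gy has_derivative (\<lambda>h. Re h * gyx z + Im h * gyy z)) (at z)"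
    and cont: "continuous_on S gxy" "continuous_on S gyx"
  shows "gxy z0 = gyx z0"
proof -
  obtain d where d: "d > 0" "ball z0 d \<subseteq> S" using S open_contains_ball by blast
  \<comment> \<open>The step size makes 2 * s n = d / (n + 2), which stays below d and tends to
    0.\<close>
  define s where "s n = d / (2 * (real n + 2))" for n
  have s: "0 < s n" "2 * s n < d" for n using d by (auto simp: s_def field_simps add_pos_nonneg)
  have "\<exists>w w'. norm (w - z0) \<le> 2 * s n \<and> norm (w' - z0) \<le> 2 * s n \<and> gxy w = gyx w'" for n
  proof -
    obtain w where w: "norm (w - z0) \<le> 2 * s n"
      "g (z0 + of_real (s n) * 1 + of_real (s n) * \<i>) - g (z0 + of_real (s n) * 1) - g (z0 + of_real (s n) * \<i>) + g z0
       = (s n)\<^sup>2 * (Re \<i> * gxx w + Im \<i> * gxy w)"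
      by (rule second_difference_mean_value[of z0 d g "\<lambda>z h. Re h * gx z + Im h * gy z" 1
            "\<lambda>z h. Re h * gxx z + Im h * gxy z" \<i> "s n"]) (use g gx d s in auto)
    obtain w' where w': "norm (w' - z0) \<le> 2 * s n"
      "g (z0 + of_real (s n) * \<i> + of_real (s n) * 1) - g (z0 + of_real (s n) * \<i>) - g (z0 + of_real (s n) * 1) + g z0
       = (s n)\<^sup>2 * (Re 1 * gyx w' + Im 1 * gyy w')"
      by (rule second_difference_mean_value[of z0 d g "\<lambda>z h. Re h * gx z + Im h * gy z" \<i>
            "\<lambda>z h. Re h * gyx z + Im h * gyy z" 1 "s n"]) (use g gy d s in auto)
    have "(s n)\<^sup>2 * gxy w = (s n)\<^sup>2 * gyx w'"
      using w(2) w'(2) by (simp add: algebra_simps)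
    then show ?thesis using w(1) w'(1) s[of n] by auto
  qed
  then obtain w w' where w: "\<And>n. norm (w n - z0) \<le> 2 * s n" "\<And>n. norm (w' n - z0) \<le> 2 * s n"
    and eq: "\<And>n. gxy (w n) = gyx (w' n)" by metis
  have "(\<lambda>n. d * inverse (real (Suc (Suc n)))) \<longlonglongrightarrow> d * 0"
    by (intro tendsto_intros LIMSEQ_Suc[OF LIMSEQ_inverse_real_of_nat])
  moreover have "2 * s n = d * inverse (real (Suc (Suc n)))" for n
    by (simp add: s_def field_simps)
  ultimately have s0: "(\<lambda>n. 2 * s n) \<longlonglongrightarrow> 0" by simp
  have lim: "v \<longlonglongrightarrow> z0" if "\<And>n. norm (v n - z0) \<le> 2 * s n" for v :: "nat \<Rightarrow> complex"
    by (rule LIM_zero_cancel, rule Lim_null_comparison[OF _ s0]) (use that in \<open>simp add: always_eventually\<close>)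
  have at: "isCont gxy z0" "isCont gyx z0"
    using cont S continuous_on_eq_continuous_at by blast+
  have "(\<lambda>n. gxy (w n)) \<longlonglongrightarrow> gxy z0" "(\<lambda>n. gyx (w' n)) \<longlonglongrightarrow> gyx z0"
    by (rule isCont_tendsto_compose[OF at(1) lim] isCont_tendsto_compose[OF at(2) lim], rule w)+
  then show ?thesis unfolding eq by (rule LIMSEQ_unique)
qed

section \<open>Harmonic functions as sums of a holomorphic and an antiholomorphic function\<close>

lemma harmonic_on_decompose:
  fixes f :: "complex \<Rightarrow> complex"
  assumes harm: "harmonic_on f S" and "convex S"
  obtains h k where "h holomorphic_on S" "k holomorphic_on S" "\<And>z. z \<in> S \<Longrightarrow> f z = h z + cnj (k z)"
proof -
  have S: "open S" using harm by (simp add: harmonic_on_def)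
  obtain ux uy uxx uxy uyx uyy where
    u: "\<And>z. z \<in> S \<Longrightarrow> (f has_derivative (\<lambda>h. Re h *\<^sub>R ux z + Im h *\<^sub>R uy z)) (at z)" and
    ux: "\<And>z. z \<in> S \<Longrightarrow> (ux has_derivative (\<lambda>h. Re h *\<^sub>R uxx z + Im h *\<^sub>R uxy z)) (at z)" and
    uy: "\<And>z. z \<in> S \<Longrightarrow> (uy has_derivative (\<lambda>h. Re h *\<^sub>R uyx z + Im h *\<^sub>R uyy z)) (at z)" and
    lap: "\<And>z. z \<in> S \<Longrightarrow> uxx z + uyy z = 0" and
    cont: "continuous_on S uxy" "continuous_on S uyx"
    using harm unfolding harmonic_on_def by (elim conjE exE) (rule that, blast+)
  \<comment> \<open>This and Laplace's equation are the Cauchy-Riemann equations for the functions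
    \<open>a\<close> and \<open>b\<close> below.\<close>
  have mixed: "uxy z = uyx z" if z: "z \<in> S" for z
  proof (rule complex_eqI)
    show "Re (uxy z) = Re (uyx z)"
      by (rule mixed_partials_eq_real[OF S z, of "\<lambda>z. Re (f z)" "\<lambda>z. Re (ux z)" "\<lambda>z. Re (uy z)"
            "\<lambda>z. Re (uxx z)" "\<lambda>z. Re (uxy z)" "\<lambda>z. Re (uyx z)" "\<lambda>z. Re (uyy z)"])
        (use has_derivative_Re[OF u] has_derivative_Re[OF ux] has_derivative_Re[OF uy] cont
          in \<open>auto intro: continuous_intros\<close>)
    show "Im (uxy z) = Im (uyx z)"
      by (rule mixed_partials_eq_real[OF S z, of "\<lambda>z. Im (f z)" "\<lambda>z. Im (ux z)" "\<lambda>z. Im (uy z)"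
            "\<lambda>z. Im (uxx z)" "\<lambda>z. Im (uxy z)" "\<lambda>z. Im (uyx z)" "\<lambda>z. Im (uyy z)"])
        (use has_derivative_Im[OF u] has_derivative_Im[OF ux] has_derivative_Im[OF uy] cont
          in \<open>auto intro: continuous_intros\<close>)
  qed
  \<comment> \<open>The Wirtinger derivatives of \<open>f\<close>, the second one conjugated; both are holomorphic.\<close>
  define a where "a z = 1/2 * (ux z - \<i> * uy z)" for z
  define b where "b z = cnj (1/2 * (ux z + \<i> * uy z))" for z
  have "(a has_field_derivative (uxx z - \<i> * uxy z) / 2) (at z)" if z: "z \<in> S" for z
    unfolding has_field_derivative_def a_def
  proof (rule has_derivative_eq_rhs)
    show "((\<lambda>z. 1/2 * (ux z - \<i> * uy z)) has_derivative
      (\<lambda>h. 1/2 * ((Re h *\<^sub>R uxx z + Im h *\<^sub>R uxy z) - \<i> * (Re h *\<^sub>R uyx z + Im h *\<^sub>R uyy z)))) (at z)"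
      by (intro has_derivative_diff has_derivative_mult_right ux uy z)
    show "(\<lambda>h. 1/2 * ((Re h *\<^sub>R uxx z + Im h *\<^sub>R uxy z) - \<i> * (Re h *\<^sub>R uyx z + Im h *\<^sub>R uyy z))) =
      (*) ((uxx z - \<i> * uxy z) / 2)"
      using mixed[OF z] lap[OF z]
      by (auto simp: fun_eq_iff complex_eq_iff add_eq_0_iff algebra_simps)
  qed
  then have a: "a holomorphic_on S" unfolding holomorphic_on_open[OF S] by blast
  have "(b has_field_derivative (cnj (uxx z) - \<i> * cnj (uxy z)) / 2) (at z)" if z: "z \<in> S" for z
    unfolding has_field_derivative_def b_def
  proof (rule has_derivative_eq_rhs)
    show "((\<lambda>z. cnj (1/2 * (ux z + \<i> * uy z))) has_derivative
      (\<lambda>h. cnj (1/2 * ((Re h *\<^sub>R uxx z + Im h *\<^sub>R uxy z) + \<i> * (Re h *\<^sub>R uyx z + Im h *\<^sub>R uyy z))))) (at z)"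
      by (intro has_derivative_cnj has_derivative_add has_derivative_mult_right ux uy z)
    show "(\<lambda>h. cnj (1/2 * ((Re h *\<^sub>R uxx z + Im h *\<^sub>R uxy z) + \<i> * (Re h *\<^sub>R uyx z + Im h *\<^sub>R uyy z)))) =
      (*) ((cnj (uxx z) - \<i> * cnj (uxy z)) / 2)"
      using mixed[OF z] lap[OF z]
      by (auto simp: fun_eq_iff complex_eq_iff add_eq_0_iff algebra_simps)
  qed
  then have b: "b holomorphic_on S" unfolding holomorphic_on_open[OF S] by blast
  obtain h where h0: "\<And>z. z \<in> S \<Longrightarrow> (h has_field_derivative a z) (at z within S)"
    using holomorphic_convex_primitive'[OF \<open>convex S\<close> S a] by blast
  have h: "(h has_field_derivative a z) (at z)" if "z \<in> S" for z
    using h0[OF that] unfolding at_within_open[OF that S] .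
  obtain k where k0: "\<And>z. z \<in> S \<Longrightarrow> (k has_field_derivative b z) (at z within S)"
    using holomorphic_convex_primitive'[OF \<open>convex S\<close> S b] by blast
  have k: "(k has_field_derivative b z) (at z)" if "z \<in> S" for z
    using k0[OF that] unfolding at_within_open[OF that S] .
  \<comment> \<open>The primitives h and k reproduce both Wirtinger derivatives of f, hence its
    whole differential; the remaining constant is absorbed into h.\<close>
  have "\<exists>c. \<forall>z\<in>S. f z - (h z + cnj (k z)) = c"
  proof (rule has_derivative_zero_constant[OF \<open>convex S\<close>])
    fix z assume z: "z \<in> S"
    have "((\<lambda>z. f z - (h z + cnj (k z))) has_derivative
        (\<lambda>v. (Re v *\<^sub>R ux z + Im v *\<^sub>R uy z) - (a z * v + cnj (b z * v)))) (at z)"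
      using h[OF z] k[OF z] unfolding has_field_derivative_def
      by (intro has_derivative_diff has_derivative_add has_derivative_cnj u z)
    moreover have "(\<lambda>v. (Re v *\<^sub>R ux z + Im v *\<^sub>R uy z) - (a z * v + cnj (b z * v))) = (\<lambda>v. 0)"
      by (auto simp: fun_eq_iff complex_eq_iff a_def b_def field_simps)
    ultimately show "((\<lambda>z. f z - (h z + cnj (k z))) has_derivative (\<lambda>v. 0)) (at z within S)"
      by (simp add: has_derivative_at_withinI)
  qed
  then obtain c where c: "\<And>z. z \<in> S \<Longrightarrow> f z - (h z + cnj (k z)) = c" by blast
  show ?thesis
  proof (rule that[of "\<lambda>z. h z + c" k])
    show "k holomorphic_on S"
      unfolding holomorphic_on_open[OF S] using k by blast
    have "h holomorphic_on S"
      unfolding holomorphic_on_open[OF S] using h by blast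
    then show "(\<lambda>z. h z + c) holomorphic_on S"
      by (intro holomorphic_intros)
    show "f z = h z + c + cnj (k z)" if "z \<in> S" for z
      using c[OF that] by (simp add: algebra_simps)
  qed
qed

lemma harmonic_on_holomorphic_add_cnj:
  assumes S: "open S" and hol: "h holomorphic_on S" "k holomorphic_on S"
  shows "harmonic_on (\<lambda>z. h z + cnj (k z)) S"
proof -
  let ?h1 = "deriv h" and ?h2 = "deriv (deriv h)" and ?k1 = "deriv k" and ?k2 = "deriv (deriv k)"
  have hol1: "?h1 holomorphic_on S" "?k1 holomorphic_on S" and hol2: "?h2 holomorphic_on S" "?k2 holomorphic_on S"
    using hol S by (auto intro!: holomorphic_deriv)
  have D: "(p has_derivative (\<lambda>v. deriv p z * v)) (at z)" if "p holomorphic_on S" "z \<in> S" for p z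
    using holomorphic_derivI[OF that(1) S that(2)] by (simp add: has_field_derivative_def)
  \<comment> \<open>Functions c * p + d * cnj q are closed under both partial derivatives: Re z
    keeps the coefficients (c, d), Im z turns them into (\<i> * c, - \<i> * d). One computation
    therefore serves the function and its first partials.\<close>
  have comb: "((\<lambda>z. c * p z + d * cnj (q z)) has_derivative
      (\<lambda>v. Re v *\<^sub>R (c * deriv p z + d * cnj (deriv q z)) + Im v *\<^sub>R (\<i> * c * deriv p z - \<i> * d * cnj (deriv q z)))) (at z)"
    if "p holomorphic_on S" "q holomorphic_on S" "z \<in> S" for p q c d z
  proof (rule has_derivative_eq_rhs)
    show "((\<lambda>z. c * p z + d * cnj (q z)) has_derivative
      (\<lambda>v. c * (deriv p z * v) + d * cnj (deriv q z * v))) (at z)"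
      using that by (intro has_derivative_add has_derivative_mult_right has_derivative_cnj D)
    show "(\<lambda>v. c * (deriv p z * v) + d * cnj (deriv q z * v)) =
      (\<lambda>v. Re v *\<^sub>R (c * deriv p z + d * cnj (deriv q z)) + Im v *\<^sub>R (\<i> * c * deriv p z - \<i> * d * cnj (deriv q z)))"
      by (auto simp: fun_eq_iff complex_eq_iff algebra_simps)
  qed
  have c2: "continuous_on S ?h2" "continuous_on S ?k2"
    using hol2 by (auto intro: holomorphic_on_imp_continuous_on)
  have c: "continuous_on S (\<lambda>z. ?h2 z + cnj (?k2 z))"
    "continuous_on S (\<lambda>z. \<i> * ?h2 z - \<i> * cnj (?k2 z))"
    "continuous_on S (\<lambda>z. - ?h2 z - cnj (?k2 z))"
    by (intro continuous_on_add continuous_on_diff continuous_on_minus continuous_on_mult_left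
      continuous_on_cnj c2)+
  show ?thesis
    unfolding harmonic_on_def
  proof (intro conjI S exI ballI)
    fix z assume z: "z \<in> S"
    show "((\<lambda>z. h z + cnj (k z)) has_derivative (\<lambda>v. Re v *\<^sub>R (\<lambda>z. 1 * ?h1 z + 1 * cnj (?k1 z)) z +
        Im v *\<^sub>R (\<lambda>z. \<i> * ?h1 z + (-\<i>) * cnj (?k1 z)) z)) (at z)"
      using comb[OF hol z, of 1 1] by simp
    show "((\<lambda>z. 1 * ?h1 z + 1 * cnj (?k1 z)) has_derivative (\<lambda>v. Re v *\<^sub>R (\<lambda>z. ?h2 z + cnj (?k2 z)) z +
        Im v *\<^sub>R (\<lambda>z. \<i> * ?h2 z - \<i> * cnj (?k2 z)) z)) (at z)"
      using comb[OF hol1 z, of 1 1] by simp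
    show "((\<lambda>z. \<i> * ?h1 z + (-\<i>) * cnj (?k1 z)) has_derivative (\<lambda>v. Re v *\<^sub>R (\<lambda>z. \<i> * ?h2 z - \<i> * cnj (?k2 z)) z +
        Im v *\<^sub>R (\<lambda>z. - ?h2 z - cnj (?k2 z)) z)) (at z)"
      using comb[OF hol1 z, of \<i> "-\<i>"] by (simp add: algebra_simps)
    show "(\<lambda>z. ?h2 z + cnj (?k2 z)) z + (\<lambda>z. - ?h2 z - cnj (?k2 z)) z = 0" by simp
  qed (rule c)+
qed

section \<open>The Poisson kernel and the Poisson formula for dilates\<close>

definition poisson_kernel :: "complex \<Rightarrow> real \<Rightarrow> real" where
  "poisson_kernel z t = (1 - (cmod z)\<^sup>2) / (cmod (cis t - z))\<^sup>2"

lemma cmod_cis_minus_ge: "cmod (cis t - z) \<ge> 1 - cmod z"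
  using norm_triangle_ineq2[of "cis t" z] by simp

lemma measurable_cis [measurable]: "cis \<in> borel_measurable borel"
  by (intro borel_measurable_continuous_onI continuous_intros)

lemma measurable_poisson_kernel [measurable]: "poisson_kernel z \<in> borel_measurable borel"
  unfolding poisson_kernel_def by measurable

lemma poisson_kernel_pos:
  assumes "cmod z < 1"
  shows "poisson_kernel z t > 0"
  unfolding poisson_kernel_def
proof (rule divide_pos_pos)
  show "0 < 1 - (cmod z)\<^sup>2"
    using assms by (simp add: power_less_one_iff)
  show "0 < (cmod (cis t - z))\<^sup>2"
    by (rule zero_less_power) (use cmod_cis_minus_ge[of z t] assms in linarith)
qed

text \<open>With \<delta> = 1 - |z| this bounds the kernel on the whole circle; with a fixed
  \<delta> it gives its decay away from a boundary point as |z| tends to 1.\<close>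

lemma poisson_kernel_le:
  assumes "0 < \<delta>" "\<delta> \<le> cmod (cis t - z)" "cmod z < 1"
  shows "poisson_kernel z t \<le> (1 - (cmod z)\<^sup>2) / \<delta>\<^sup>2"
  unfolding poisson_kernel_def
proof (rule divide_left_mono)
  show "\<delta>\<^sup>2 \<le> (cmod (cis t - z))\<^sup>2" using assms by (intro power_mono) auto
  show "0 \<le> 1 - (cmod z)\<^sup>2" using assms by (simp add: power_le_one)
  have "0 < cmod (cis t - z)" using assms by linarith
  then show "0 < (cmod (cis t - z))\<^sup>2 * \<delta>\<^sup>2" using assms(1) by simp
qed

lemma integrable_poisson_kernel:
  fixes f :: "real \<Rightarrow> complex"
  assumes "cmod z < 1" "f \<in> borel_measurable borel" "\<And>t. cmod (f t) \<le> B"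
  shows "integrable circ (\<lambda>t. of_real (poisson_kernel z t) * f t)"
proof (rule integrable_circ)
  have "0 \<le> B" by (rule order_trans[OF norm_ge_zero assms(3)])
  show "cmod (of_real (poisson_kernel z t) * f t) \<le> (1 - (cmod z)\<^sup>2) / (1 - cmod z)\<^sup>2 * B" for t
    unfolding norm_mult norm_of_real
  proof (intro mult_mono assms(3) norm_ge_zero)
    show "\<bar>poisson_kernel z t\<bar> \<le> (1 - (cmod z)\<^sup>2) / (1 - cmod z)\<^sup>2"
      using poisson_kernel_le[of "1 - cmod z" t z] cmod_cis_minus_ge[of z t] poisson_kernel_pos[of z t] assms(1)
      by simp
    show "0 \<le> (1 - (cmod z)\<^sup>2) / (1 - cmod z)\<^sup>2"
      using assms(1) by (simp add: power_le_one)
  qed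
qed (use assms in measurable)

lemma poisson_integral_eq:
  assumes "\<phi> \<in> borel_measurable borel"
  shows "poisson_integral \<phi> z = integral\<^sup>L circ (\<lambda>t. of_real (poisson_kernel z t) * \<phi> t)"
  unfolding poisson_integral_def poisson_kernel_def[symmetric]
  using assms by (intro integral_circ_complex) measurable

text \<open>For \<zeta> on the unit circle \<zeta> * cnj \<zeta> = 1, so 1 - cnj z * \<zeta> =
  \<zeta> * cnj (\<zeta> - z), and multiplication by \<zeta> - z produces |\<zeta> - z|^2.\<close>

lemma cauchy_kernel_eq:
  assumes "cmod z < 1"
  shows "cis t / ((1 - cnj z * cis t) * (cis t - z)) * of_real (1 - (cmod z)\<^sup>2) = of_real (poisson_kernel z t)"
proof -
  have "1 - cnj z * cis t = cis t * cnj (cis t - z)"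
    using cis_mult[of t "-t"] by (simp add: algebra_simps cis_cnj)
  moreover have "cnj (cis t - z) * (cis t - z) = of_real ((cmod (cis t - z))\<^sup>2)"
    by (metis complex_norm_square mult.commute of_real_power)
  ultimately have "(1 - cnj z * cis t) * (cis t - z) = cis t * of_real ((cmod (cis t - z))\<^sup>2)"
    by (simp add: mult.assoc)
  then show ?thesis by (simp add: poisson_kernel_def)
qed

lemma poisson_formula_holomorphic:
  assumes h: "h holomorphic_on cball 0 1" and z: "cmod z < 1"
  shows "integral\<^sup>L circ (\<lambda>t. of_real (poisson_kernel z t) * h (cis t)) = h z"
proof -
  \<comment> \<open>Dividing by \<open>1 - cnj z * \<zeta>\<close> turns the Cauchy kernel at \<open>z\<close> into the Poisson kernel on the circle.\<close>
  define q where "q \<zeta> = h \<zeta> / (1 - cnj z * \<zeta>)" for \<zeta>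
  have ne: "1 - cnj z * \<zeta> \<noteq> 0" if "cmod \<zeta> \<le> 1" for \<zeta>
  proof
    assume "1 - cnj z * \<zeta> = 0"
    then have "cmod z * cmod \<zeta> = 1" by (metis complex_mod_cnj eq_iff_diff_eq_0 norm_mult norm_one)
    moreover have "cmod z * cmod \<zeta> \<le> cmod z * 1" using that by (intro mult_left_mono) auto
    ultimately show False using z by simp
  qed
  have "q holomorphic_on cball 0 1"
    unfolding q_def using h ne by (intro holomorphic_intros) auto
  then have "((\<lambda>u. q u / (u - z)) has_contour_integral (2 * of_real pi * \<i> * q z)) (circlepath 0 1)"
    by (rule Cauchy_integral_circlepath_simple) (use z in simp)
  then have "((\<lambda>t. q (cis t) / (cis t - z) * \<i> * cis t) has_integral (2 * of_real pi * \<i> * q z)) {0..2*pi}"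
    unfolding circlepath_def by (subst (asm) has_contour_integral_part_circlepath_iff) auto
  then have I0: "((\<lambda>t. q (cis t) / (cis t - z) * \<i> * cis t * (of_real (1 - (cmod z)\<^sup>2) / \<i>)) has_integral
      (2 * of_real pi * \<i> * q z * (of_real (1 - (cmod z)\<^sup>2) / \<i>))) {0..2*pi}"
    by (rule has_integral_mult_left)
  have e1: "q (cis t) / (cis t - z) * \<i> * cis t * (of_real (1 - (cmod z)\<^sup>2) / \<i>) =
      of_real (poisson_kernel z t) * h (cis t)" for t
  proof -
    have "a * \<i> * b * (R / \<i>) = a * b * R * (\<i> / \<i>)" for a b R :: complex
      by (simp only: times_divide_eq_right mult_ac)
    then have "q (cis t) / (cis t - z) * \<i> * cis t * (of_real (1 - (cmod z)\<^sup>2) / \<i>) =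
        q (cis t) / (cis t - z) * cis t * of_real (1 - (cmod z)\<^sup>2) * (\<i> / \<i>)" .
    also have "\<dots> = q (cis t) / (cis t - z) * cis t * of_real (1 - (cmod z)\<^sup>2)"
      by simp
    also have "\<dots> = cis t / ((1 - cnj z * cis t) * (cis t - z)) * of_real (1 - (cmod z)\<^sup>2) * h (cis t)"
      by (simp add: q_def)
    finally show ?thesis unfolding cauchy_kernel_eq[OF z] .
  qed
  \<comment> \<open>At \<zeta> = z the denominator of \<open>q\<close> is the numerator of the
    Poisson kernel, so the two cancel and h z remains.\<close>
  have "1 - cnj z * z = of_real (1 - (cmod z)\<^sup>2)"
    by (metis complex_norm_square mult.commute of_real_1 of_real_diff)
  then have e2: "2 * of_real pi * \<i> * q z * (of_real (1 - (cmod z)\<^sup>2) / \<i>) = of_real (2*pi) * h z"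
    using ne[of z] z by (simp add: q_def)
  have I: "((\<lambda>t. of_real (poisson_kernel z t) * h (cis t)) has_integral (of_real (2*pi) * h z)) {0..2*pi}"
    using I0 unfolding e1 e2 .
  have c: "continuous_on UNIV (\<lambda>t. of_real (poisson_kernel z t) * h (cis t))"
  proof (intro continuous_intros)
    have "cis t \<noteq> z" for t using z by (metis less_irrefl norm_cis)
    then show "continuous_on UNIV (poisson_kernel z)"
      unfolding poisson_kernel_def by (intro continuous_intros) auto
    show "continuous_on UNIV (\<lambda>t. h (cis t))"
      by (rule continuous_on_compose2[OF holomorphic_on_imp_continuous_on[OF h]]) (auto intro: continuous_intros)
  qed
  then have "set_integrable lborel {0..2*pi} (\<lambda>t. of_real (poisson_kernel z t) * h (cis t))"
    unfolding set_integrable_def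
    by (intro borel_integrable_compact) (auto elim: continuous_on_subset)
  from set_borel_integral_eq_integral(2)[OF this]
  have "(LINT t:{0..2*pi}|lborel. of_real (poisson_kernel z t) * h (cis t)) = of_real (2*pi) * h z"
    using I by (simp add: integral_unique)
  then show ?thesis
    using integral_circ_complex[OF borel_measurable_continuous_onI[OF c]] by simp
qed

lemma integral_poisson_kernel:
  assumes "cmod z < 1"
  shows "integral\<^sup>L circ (poisson_kernel z) = 1"
  using poisson_formula_holomorphic[of "\<lambda>_. 1", OF _ assms] by (simp add: of_real_eq_1_iff)

text \<open>Nothing is known about f on the circle itself. For \<rho> < 1 the dilates of both
  holomorphic parts are holomorphic up to the circle, and the formula passes to the conjugated part
  because the kernel is real.\<close>

lemma poisson_formula_harmonic:
  assumes f: "harmonic_on f unit_disc" and \<rho>: "0 \<le> \<rho>" "\<rho> < 1" and z: "cmod z < 1"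
  shows "continuous_on UNIV (\<lambda>t. f (of_real \<rho> * cis t))"
    and "poisson_integral (\<lambda>t. f (of_real \<rho> * cis t)) z = f (of_real \<rho> * z)"
proof -
  obtain h k where hk: "h holomorphic_on unit_disc" "k holomorphic_on unit_disc"
    and fhk: "\<And>z. z \<in> unit_disc \<Longrightarrow> f z = h z + cnj (k z)"
    using harmonic_on_decompose[OF f] by auto
  have sub: "(\<lambda>z. of_real \<rho> * z) ` cball 0 1 \<subseteq> unit_disc"
  proof safe
    fix z :: complex assume "z \<in> cball 0 1"
    then have "\<rho> * cmod z \<le> \<rho> * 1" using \<rho> by (intro mult_left_mono) auto
    then show "of_real \<rho> * z \<in> unit_disc" using \<rho> by (simp add: norm_mult)
  qed
  have hol: "(\<lambda>z. p (of_real \<rho> * z)) holomorphic_on cball 0 1" if "p holomorphic_on unit_disc" for p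
    using holomorphic_on_compose_gen[OF _ that sub] by (simp add: o_def holomorphic_intros)
  have cont: "continuous_on UNIV (\<lambda>t. p (of_real \<rho> * cis t))" if "p holomorphic_on unit_disc" for p
    by (rule continuous_on_compose2[OF holomorphic_on_imp_continuous_on[OF hol[OF that]], of _ cis])
      (auto intro: continuous_intros)
  have eq: "f (of_real \<rho> * w) = h (of_real \<rho> * w) + cnj (k (of_real \<rho> * w))" if "w \<in> cball 0 1" for w
    using that by (intro fhk subsetD[OF sub]) blast
  show c: "continuous_on UNIV (\<lambda>t. f (of_real \<rho> * cis t))"
    using cont[OF hk(1)] cont[OF hk(2)] by (simp add: eq continuous_intros)
  have int: "integrable circ (\<lambda>t. of_real (poisson_kernel z t) * p (of_real \<rho> * cis t))"
    if p: "p holomorphic_on unit_disc" for p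
  proof -
    have "compact ((\<lambda>z. p (of_real \<rho> * z)) ` cball 0 1)"
      by (intro compact_continuous_image holomorphic_on_imp_continuous_on hol p) simp
    then obtain B where "\<forall>x \<in> (\<lambda>z. p (of_real \<rho> * z)) ` cball 0 1. cmod x \<le> B"
      unfolding bounded_iff[symmetric] using compact_imp_bounded by (meson bounded_iff)
    then have "cmod (p (of_real \<rho> * w)) \<le> B" if "w \<in> cball 0 1" for w using that by blast
    then show ?thesis
      by (intro integrable_poisson_kernel[where B = B] z borel_measurable_continuous_onI cont p) simp
  qed
  have "poisson_integral (\<lambda>t. f (of_real \<rho> * cis t)) z =
      integral\<^sup>L circ (\<lambda>t. of_real (poisson_kernel z t) * h (of_real \<rho> * cis t) +
        cnj (of_real (poisson_kernel z t) * k (of_real \<rho> * cis t)))"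
    by (subst poisson_integral_eq[OF borel_measurable_continuous_onI[OF c]]) (simp add: eq distrib_left)
  also have "\<dots> = integral\<^sup>L circ (\<lambda>t. of_real (poisson_kernel z t) * h (of_real \<rho> * cis t)) +
      cnj (integral\<^sup>L circ (\<lambda>t. of_real (poisson_kernel z t) * k (of_real \<rho> * cis t)))"
    using int[OF hk(1)] int[OF hk(2)]
    by (subst Bochner_Integration.integral_add) (auto simp del: complex_cnj_mult)
  also have "\<dots> = h (of_real \<rho> * z) + cnj (k (of_real \<rho> * z))"
    using poisson_formula_holomorphic[OF hol[OF hk(1)] z] poisson_formula_holomorphic[OF hol[OF hk(2)] z] by simp
  also have "\<dots> = f (of_real \<rho> * z)" using z eq[of z] by simp
  finally show "poisson_integral (\<lambda>t. f (of_real \<rho> * cis t)) z = f (of_real \<rho> * z)" .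
qed

lemma measurable_cnj [measurable]: "cnj \<in> borel_measurable borel"
  by (intro borel_measurable_continuous_onI continuous_intros)

section \<open>Poisson integrals of bounded boundary functions\<close>

text \<open>The Cauchy integral of \<phi>, with d\<zeta> written as i \<zeta> dt. Since the Poisson
  kernel is 2 * Re (\<zeta> / (\<zeta> - z)) - 1, two such transforms express the Poisson integral;
  harmonicity and the differential at 0 then follow from power series, without differentiating under
  the integral.\<close>

definition cauchy_transform :: "(real \<Rightarrow> complex) \<Rightarrow> complex \<Rightarrow> complex" where
  "cauchy_transform \<phi> z = integral\<^sup>L circ (\<lambda>t. \<phi> t * (cis t / (cis t - z)))"

text \<open>Termwise integration of the geometric series of 1 / (1 - cis (- t) * z), dominated by B
  * |z|^n. The coefficients are the Fourier coefficients of nonnegative index.\<close>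

lemma cauchy_transform_sums:
  assumes \<phi> [measurable]: "\<phi> \<in> borel_measurable borel" and b: "\<And>t. cmod (\<phi> t) \<le> B" and z: "cmod z < 1"
  shows "(\<lambda>n. integral\<^sup>L circ (\<lambda>t. \<phi> t * cis (- t) ^ n) * z ^ n) sums cauchy_transform \<phi> z"
proof -
  have B: "0 \<le> B" by (rule order_trans[OF norm_ge_zero b])
  let ?f = "\<lambda>n t. \<phi> t * cis (- t) ^ n * z ^ n"
  have fb: "cmod (?f n t) \<le> B * cmod z ^ n" for n t
    using b[of t] by (simp add: norm_mult norm_power mult_right_mono)
  have summ: "summable (\<lambda>n. B * cmod z ^ n)"
    using z by (intro summable_mult summable_geometric) simp
  have m: "?f n \<in> borel_measurable borel" for n by measurable
  have int: "integrable circ (?f n)" for n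
    by (rule integrable_circ[OF m fb])
  have "(\<lambda>n. integral\<^sup>L circ (?f n)) sums (integral\<^sup>L circ (\<lambda>t. \<Sum>n. ?f n t))"
  proof (rule sums_integral[OF int])
    show "AE t in circ. summable (\<lambda>n. norm (?f n t))"
      by (rule AE_I2, rule summable_comparison_test_ev[OF _ summ]) (use fb in \<open>simp add: always_eventually\<close>)
    show "summable (\<lambda>n. \<integral>t. norm (?f n t) \<partial>circ)"
    proof (rule summable_comparison_test_ev[OF _ summ], rule always_eventually, rule allI)
      fix n
      have "(\<integral>t. norm (?f n t) \<partial>circ) \<le> (\<integral>t. B * cmod z ^ n \<partial>circ)"
        by (rule integral_mono) (use int fb in auto)
      then show "norm (\<integral>t. norm (?f n t) \<partial>circ) \<le> B * cmod z ^ n"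
        by simp
    qed
  qed
  moreover have "(\<Sum>n. ?f n t) = \<phi> t * (cis t / (cis t - z))" for t
  proof -
    have "norm (cis (- t) * z) < 1" using z by (simp add: norm_mult)
    then have "(\<lambda>n. \<phi> t * (cis (- t) * z) ^ n) sums (\<phi> t * (1 / (1 - cis (- t) * z)))"
      by (intro sums_mult geometric_sums)
    moreover have "1 / (1 - cis (- t) * z) = cis t / (cis t - z)"
    proof -
      have "cis t - z = cis t * (1 - cis (- t) * z)"
        using cis_mult[of t "- t"] by (simp add: algebra_simps flip: mult.assoc)
      then show ?thesis by simp
    qed
    ultimately show ?thesis
      by (simp add: sums_iff power_mult_distrib mult.assoc)
  qed
  ultimately show ?thesis
    unfolding cauchy_transform_def by simp
qed

lemma cauchy_transform_holomorphic:
  assumes "\<phi> \<in> borel_measurable borel" "\<And>t. cmod (\<phi> t) \<le> B"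
  shows "cauchy_transform \<phi> holomorphic_on unit_disc"
  by (rule power_series_holomorphic[of _ _ "\<lambda>n. integral\<^sup>L circ (\<lambda>t. \<phi> t * cis (- t) ^ n)"])
    (use cauchy_transform_sums[OF assms] in simp)

lemma cauchy_transform_deriv_0:
  assumes "\<phi> \<in> borel_measurable borel" "\<And>t. cmod (\<phi> t) \<le> B"
  shows "(cauchy_transform \<phi> has_field_derivative integral\<^sup>L circ (\<lambda>t. \<phi> t * cis (- t))) (at 0)"
proof -
  define a where "a n = integral\<^sup>L circ (\<lambda>t. \<phi> t * cis (- t) ^ n)" for n
  have sums: "(\<lambda>n. a n * z ^ n) sums cauchy_transform \<phi> z" if "cmod z < 1" for z
    unfolding a_def by (rule cauchy_transform_sums[OF assms that])
  have "((\<lambda>z. \<Sum>n. a n * z ^ n) has_field_derivative (\<Sum>n. diffs a n * 0 ^ n)) (at 0)"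
    by (rule termdiffs_strong'[of 1]) (use sums in \<open>auto simp: sums_iff\<close>)
  then have "((\<lambda>z. \<Sum>n. a n * z ^ n) has_field_derivative a 1) (at 0)"
    by (simp add: diffs_def)
  then have "(cauchy_transform \<phi> has_field_derivative a 1) (at 0)"
    by (rule has_field_derivative_transform_within_open[of _ _ _ unit_disc])
      (use sums in \<open>auto simp: sums_iff\<close>)
  then show ?thesis by (simp add: a_def)
qed

lemma poisson_kernel_eq_cauchy:
  assumes "cmod z < 1"
  shows "complex_of_real (poisson_kernel z t) = cis t / (cis t - z) + cnj (cis t / (cis t - z)) - 1"
proof -
  let ?d = "cis t - z"
  have "cmod ?d > 0" using cmod_cis_minus_ge[of z t] assms by linarith
  then have d: "?d \<noteq> 0" "cnj ?d \<noteq> 0" by auto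
  have cc: "cis t * cnj (cis t) = 1" using cis_mult[of t "-t"] by (simp add: cis_cnj)
  have zz: "complex_of_real ((cmod z)\<^sup>2) = z * cnj z" by (rule complex_norm_square)
  have dd: "complex_of_real ((cmod ?d)\<^sup>2) = ?d * cnj ?d" by (rule complex_norm_square)
  have "cis t / ?d + cnj (cis t / ?d) - 1 = (cis t * cnj ?d + cnj (cis t) * ?d - ?d * cnj ?d) / (?d * cnj ?d)"
    using d by (simp add: divide_simps del: complex_cnj_diff)
  also have "cis t * cnj ?d + cnj (cis t) * ?d - ?d * cnj ?d = cis t * cnj (cis t) - z * cnj z"
    by (simp add: algebra_simps)
  also have "\<dots> / (?d * cnj ?d) = complex_of_real (poisson_kernel z t)"
    unfolding poisson_kernel_def cc of_real_divide of_real_diff zz dd by simp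
  finally show ?thesis by simp
qed

lemma poisson_integral_eq_cauchy:
  assumes [measurable]: "\<phi> \<in> borel_measurable borel" and b: "\<And>t. cmod (\<phi> t) \<le> B" and z: "cmod z < 1"
  shows "poisson_integral \<phi> z = cauchy_transform \<phi> z - integral\<^sup>L circ \<phi>
    + cnj (cauchy_transform (\<lambda>t. cnj (\<phi> t)) z)"
proof -
  let ?k = "\<lambda>t. cis t / (cis t - z)"
  have B: "0 \<le> B" by (rule order_trans[OF norm_ge_zero b])
  have kb: "cmod (?k t) \<le> 1 / (1 - cmod z)" for t
    using cmod_cis_minus_ge[of z t] z by (simp add: norm_divide frac_le)
  have cb: "cmod (\<phi> t * ?k t) \<le> B * (1 / (1 - cmod z))" for t
    unfolding norm_mult using b kb B by (intro mult_mono) auto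
  have int1: "integrable circ (\<lambda>t. \<phi> t * ?k t)"
    by (rule integrable_circ[OF _ cb]) measurable
  have int2: "integrable circ (\<lambda>t. cnj (\<phi> t) * ?k t)"
    by (rule integrable_circ[where B = "B * (1 / (1 - cmod z))"])
      (measurable, use cb in \<open>simp add: norm_mult norm_divide\<close>)
  have int4: "integrable circ (\<lambda>t. cnj (cnj (\<phi> t) * ?k t))"
    using int2 by (simp only: complex_integrable_cnj)
  have int3: "integrable circ \<phi>" by (rule integrable_circ[OF _ b]) measurable
  have "poisson_integral \<phi> z = integral\<^sup>L circ (\<lambda>t. (\<phi> t * ?k t - \<phi> t) + cnj (cnj (\<phi> t) * ?k t))"
    by (subst poisson_integral_eq) (simp_all add: poisson_kernel_eq_cauchy[OF z] algebra_simps)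
  also have "\<dots> = (integral\<^sup>L circ (\<lambda>t. \<phi> t * ?k t) - integral\<^sup>L circ \<phi>) + integral\<^sup>L circ (\<lambda>t. cnj (cnj (\<phi> t) * ?k t))"
    by (subst Bochner_Integration.integral_add[OF Bochner_Integration.integrable_diff[OF int1 int3] int4])
      (simp only: Bochner_Integration.integral_diff[OF int1 int3])
  also have "integral\<^sup>L circ (\<lambda>t. cnj (cnj (\<phi> t) * ?k t)) = cnj (integral\<^sup>L circ (\<lambda>t. cnj (\<phi> t) * ?k t))"
    by (rule Bochner_Integration.integral_cnj)
  finally show ?thesis by (simp add: cauchy_transform_def)
qed

lemma harmonic_on_transform:
  assumes f: "harmonic_on f S" and eq: "\<And>z. z \<in> S \<Longrightarrow> f z = g z"
  shows "harmonic_on g S"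
proof -
  have S: "open S" using f by (simp add: harmonic_on_def)
  have "(f has_derivative D) (at z) \<longleftrightarrow> (g has_derivative D) (at z)" if "z \<in> S" for D z
    using has_derivative_transform_within_open[OF _ S that] eq by metis
  then show ?thesis
    using f unfolding harmonic_on_def by (simp cong: ball_cong)
qed

lemma poisson_integral_harmonic:
  assumes m [measurable]: "\<phi> \<in> borel_measurable borel" and b: "\<And>t. cmod (\<phi> t) \<le> B"
  shows "harmonic_on (poisson_integral \<phi>) unit_disc"
proof -
  have b': "cmod (cnj (\<phi> t)) \<le> B" for t using b by simp
  have m': "(\<lambda>t. cnj (\<phi> t)) \<in> borel_measurable borel" by measurable
  have "harmonic_on (\<lambda>z. (cauchy_transform \<phi> z - integral\<^sup>L circ \<phi>)
    + cnj (cauchy_transform (\<lambda>t. cnj (\<phi> t)) z)) unit_disc"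
    by (intro harmonic_on_holomorphic_add_cnj holomorphic_intros cauchy_transform_holomorphic[OF m b]
        cauchy_transform_holomorphic[OF m' b'] open_ball)
  then show ?thesis
    by (rule harmonic_on_transform) (use poisson_integral_eq_cauchy[OF m b] in simp)
qed

lemma poisson_integral_0:
  "\<phi> \<in> borel_measurable borel \<Longrightarrow> poisson_integral \<phi> 0 = integral\<^sup>L circ \<phi>"
  by (simp add: poisson_integral_eq poisson_kernel_def)

text \<open>The two Cauchy transforms contribute cis (\<alpha> - t) and its conjugate, with sum 2 *
  cos (t - \<alpha>). This is the origin of the factor 2 in \<open>MM\<close>.\<close>

lemma poisson_integral_has_derivative_0:
  assumes m [measurable]: "\<phi> \<in> borel_measurable borel" and b: "\<And>t. cmod (\<phi> t) \<le> B"
  obtains D where "(poisson_integral \<phi> has_derivative D) (at 0)"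
    "\<And>\<alpha>. D (cis \<alpha>) = 2 * integral\<^sup>L circ (\<lambda>t. \<phi> t * of_real (cos (t - \<alpha>)))"
proof -
  have b': "cmod (cnj (\<phi> t)) \<le> B" for t using b by simp
  have m': "(\<lambda>t. cnj (\<phi> t)) \<in> borel_measurable borel" by measurable
  define a where "a = integral\<^sup>L circ (\<lambda>t. \<phi> t * cis (- t))"
  define c where "c = integral\<^sup>L circ (\<lambda>t. cnj (\<phi> t) * cis (- t))"
  have "((\<lambda>z. cauchy_transform \<phi> z - integral\<^sup>L circ \<phi> + cnj (cauchy_transform (\<lambda>t. cnj (\<phi> t)) z))
      has_derivative (\<lambda>v. a * v - 0 + cnj (c * v))) (at 0)"
    using cauchy_transform_deriv_0[OF m b] cauchy_transform_deriv_0[OF m' b']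
    unfolding has_field_derivative_def a_def c_def
    by (intro has_derivative_add has_derivative_diff has_derivative_const has_derivative_cnj)
  then have D: "(poisson_integral \<phi> has_derivative (\<lambda>v. a * v - 0 + cnj (c * v))) (at 0)"
    by (rule has_derivative_transform_within_open[of _ _ _ _ unit_disc])
      (use poisson_integral_eq_cauchy[OF m b] in auto)
  have int: "integrable circ (\<lambda>t. \<phi> t * cis (s t))" if [measurable]: "s \<in> borel_measurable borel" for s
    by (rule integrable_circ[where B = B]) (measurable, use b in \<open>simp add: norm_mult\<close>)
  show ?thesis
  proof (rule that[OF D])
    fix \<alpha>
    have "a * cis \<alpha> = integral\<^sup>L circ (\<lambda>t. \<phi> t * cis (\<alpha> - t))"
      unfolding a_def by (subst integral_mult_left_zero[symmetric]) (simp add: mult.assoc cis_mult)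
    moreover have "cnj (c * cis \<alpha>) = integral\<^sup>L circ (\<lambda>t. \<phi> t * cis (t - \<alpha>))"
      unfolding c_def
      by (subst integral_mult_left_zero[symmetric], subst Bochner_Integration.integral_cnj[symmetric])
        (simp add: mult.assoc cis_mult cis_cnj)
    ultimately have "a * cis \<alpha> - 0 + cnj (c * cis \<alpha>) =
        integral\<^sup>L circ (\<lambda>t. \<phi> t * cis (\<alpha> - t) + \<phi> t * cis (t - \<alpha>))"
      using int by (simp add: Bochner_Integration.integral_add)
    also have "\<dots> = integral\<^sup>L circ (\<lambda>t. 2 * (\<phi> t * of_real (cos (t - \<alpha>))))"
    proof (rule Bochner_Integration.integral_cong[OF refl])
      fix t
      have "cis (\<alpha> - t) + cis (t - \<alpha>) = 2 * of_real (cos (t - \<alpha>))"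
        using cos_minus[of "t - \<alpha>"] sin_minus[of "t - \<alpha>"] by (simp add: complex_eq_iff)
      then show "\<phi> t * cis (\<alpha> - t) + \<phi> t * cis (t - \<alpha>) = 2 * (\<phi> t * of_real (cos (t - \<alpha>)))"
        by (simp flip: distrib_left)
    qed
    finally show "a * cis \<alpha> - 0 + cnj (c * cis \<alpha>) = 2 * integral\<^sup>L circ (\<lambda>t. \<phi> t * of_real (cos (t - \<alpha>)))"
      by simp
  qed
qed

text \<open>A strict maximum principle, which keeps the constructed maps inside the open polydisc.
  If the value P had modulus at least 1, then, with c the phase of P, positivity of the kernel would
  force Re (cnj c * \<phi>) = 1 almost everywhere, and the mean of \<phi> would have modulus 1
  too.\<close>

lemma norm_poisson_integral_less_1:
  assumes m [measurable]: "\<phi> \<in> borel_measurable borel" and b: "\<And>t. cmod (\<phi> t) \<le> 1"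
    and mean: "cmod (integral\<^sup>L circ \<phi>) < 1" and z: "cmod z < 1"
  shows "cmod (poisson_integral \<phi> z) < 1"
proof (rule ccontr)
  assume "\<not> ?thesis"
  then have ge: "cmod (poisson_integral \<phi> z) \<ge> 1" by simp
  define P where "P = poisson_integral \<phi> z"
  define c where "c = sgn P"
  have c: "cmod c = 1" "cnj c * P = of_real (cmod P)"
  proof -
    have P: "P \<noteq> 0" using ge by (auto simp: P_def)
    then show "cmod c = 1" by (simp add: c_def norm_sgn)
    have "P * cnj P = of_real (cmod P) * of_real (cmod P)"
      using complex_norm_square[of P] by (simp add: power2_eq_square)
    with P show "cnj c * P = of_real (cmod P)"
      by (simp add: c_def sgn_eq mult.commute)
  qed
  have Re_le: "Re (cnj c * \<phi> t) \<le> 1" for t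
    using complex_Re_le_cmod[of "cnj c * \<phi> t"] b[of t] c by (simp add: norm_mult)
  have int: "integrable circ (\<lambda>t. of_real (poisson_kernel z t) * \<phi> t)"
    by (rule integrable_poisson_kernel[OF z m b])
  have intk: "integrable circ (poisson_kernel z)"
    using integrable_Re[OF integrable_poisson_kernel[OF z, of "\<lambda>_. 1" 1]] by simp
  have int2: "integrable circ (\<lambda>t. poisson_kernel z t * Re (cnj c * \<phi> t))"
    using integrable_Re[OF integrable_mult_right[OF int, of "cnj c"]]
    by (rule Bochner_Integration.integrable_cong[THEN iffD1, rotated -1]) (auto simp: algebra_simps)
  have "integral\<^sup>L circ (\<lambda>t. poisson_kernel z t * Re (cnj c * \<phi> t)) =
      Re (cnj c * integral\<^sup>L circ (\<lambda>t. of_real (poisson_kernel z t) * \<phi> t))"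
    unfolding integral_mult_right_zero[symmetric] using int
    by (subst integral_Re[symmetric]) (auto intro!: Bochner_Integration.integral_cong simp: algebra_simps)
  also have "\<dots> = cmod P"
    unfolding poisson_integral_eq[OF m, symmetric] P_def[symmetric] c by simp
  finally have "integral\<^sup>L circ (\<lambda>t. poisson_kernel z t * Re (cnj c * \<phi> t)) = cmod P" .
  then have "integral\<^sup>L circ (\<lambda>t. poisson_kernel z t - poisson_kernel z t * Re (cnj c * \<phi> t)) = 1 - cmod P"
    using intk int2 integral_poisson_kernel[OF z] by (simp add: Bochner_Integration.integral_diff)
  moreover have nonneg: "0 \<le> poisson_kernel z t - poisson_kernel z t * Re (cnj c * \<phi> t)" for t
    using mult_left_mono[OF Re_le[of t], of "poisson_kernel z t"] poisson_kernel_pos[OF z, of t] by simp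
  ultimately have "integral\<^sup>L circ (\<lambda>t. poisson_kernel z t - poisson_kernel z t * Re (cnj c * \<phi> t)) = 0"
    using ge Bochner_Integration.integral_nonneg[of circ "\<lambda>t. poisson_kernel z t - poisson_kernel z t * Re (cnj c * \<phi> t)"]
    unfolding P_def[symmetric] by force
  then have "AE t in circ. poisson_kernel z t - poisson_kernel z t * Re (cnj c * \<phi> t) = 0"
    using intk int2 nonneg by (subst (asm) integral_nonneg_eq_0_iff_AE) auto
  then have ae: "AE t in circ. Re (cnj c * \<phi> t) = 1"
    by eventually_elim (use poisson_kernel_pos[OF z] in \<open>auto simp: less_le\<close>)
  have intp: "integrable circ (\<lambda>t. cnj c * \<phi> t)"
    by (intro integrable_mult_right integrable_circ[OF m b])
  have "Re (cnj c * integral\<^sup>L circ \<phi>) = integral\<^sup>L circ (\<lambda>t. Re (cnj c * \<phi> t))"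
    unfolding integral_mult_right_zero[symmetric] integral_Re[OF intp] ..
  also have "\<dots> = integral\<^sup>L circ (\<lambda>t. 1)"
    by (rule integral_cong_AE) (use ae in measurable)
  finally have "Re (cnj c * integral\<^sup>L circ \<phi>) = 1" by simp
  then show False
    using complex_Re_le_cmod[of "cnj c * integral\<^sup>L circ \<phi>"] mean c by (simp add: norm_mult)
qed

text \<open>Continuity is required of a function \<open>G\<close> on the plane, so that angles near
  0 and near 2 pi count as close. Near the boundary point continuity makes the integrand small;
  elsewhere the kernel is small and G varies by at most 2.\<close>

lemma poisson_integral_radial_limit:
  assumes m [measurable]: "(\<lambda>t. G (cis t)) \<in> borel_measurable borel" and b: "\<And>t. cmod (G (cis t)) \<le> 1"
    and cont: "isCont G (cis t0)"
  shows "has_radial_limit (poisson_integral (\<lambda>t. G (cis t))) t0 (G (cis t0))"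
  unfolding has_radial_limit_def
proof (rule tendstoI)
  fix e :: real assume e: "e > 0"
  obtain d where d: "d > 0" "\<And>w. dist w (cis t0) < d \<Longrightarrow> dist (G w) (G (cis t0)) < e / 2"
    using cont e unfolding continuous_at_eps_delta by (metis half_gt_zero)
  have "((\<lambda>\<rho>. 2 * ((1 - \<rho>\<^sup>2) / (d/2)\<^sup>2)) \<longlongrightarrow> 2 * ((1 - 1\<^sup>2) / (d/2)\<^sup>2)) (at_left (1::real))"
    using d by (intro tendsto_intros) auto
  then have "\<forall>\<^sub>F \<rho> in at_left 1. 2 * ((1 - \<rho>\<^sup>2) / (d/2)\<^sup>2) < e / 2"
    using e by (intro order_tendstoD(2)[where a = "e/2"]) auto
  \<comment> \<open>Puts z within d/2 of \<open>cis t0\<close>, so points of the circle at distance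
    at least d from \<open>cis t0\<close> stay at distance at least d/2 from z.\<close>
  moreover have "\<forall>\<^sub>F \<rho> in at_left 1. \<rho> > max 0 (1 - d/2)"
    using d by (intro eventually_at_leftI[of "max 0 (1 - d/2)"]) auto
  moreover have "\<forall>\<^sub>F \<rho> in at_left (1::real). \<rho> < 1"
    by (simp add: eventually_at_filter)
  ultimately show "\<forall>\<^sub>F \<rho> in at_left 1. dist (poisson_integral (\<lambda>t. G (cis t)) (of_real \<rho> * cis t0)) (G (cis t0)) < e"
  proof eventually_elim
    case (elim \<rho>)
    define z where "z = of_real \<rho> * cis t0"
    have z: "cmod z = \<rho>" "cmod z < 1" using elim by (auto simp: z_def norm_mult)
    define K where "K = (1 - \<rho>\<^sup>2) / (d/2)\<^sup>2"
    have K: "K \<ge> 0" using elim by (auto simp: K_def power_le_one)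
    have kn: "poisson_kernel z t \<ge> 0" for t using poisson_kernel_pos[OF z(2), of t] by simp
    have bound: "cmod (of_real (poisson_kernel z t) * (G (cis t) - G (cis t0))) \<le> poisson_kernel z t * (e/2) + 2 * K" for t
    proof (cases "dist (cis t) (cis t0) < d")
      case True
      then have "cmod (G (cis t) - G (cis t0)) \<le> e/2" using d(2) by (simp add: dist_norm less_imp_le)
      then have "poisson_kernel z t * cmod (G (cis t) - G (cis t0)) \<le> poisson_kernel z t * (e/2)"
        using kn by (intro mult_left_mono)
      then show ?thesis using K kn[of t] by (simp add: norm_mult)
    next
      case False
      have "cis t0 - z = of_real (1 - \<rho>) * cis t0" by (simp add: z_def algebra_simps)
      then have "cmod (cis t0 - z) = 1 - \<rho>" using elim by (simp add: norm_mult del: of_real_diff)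
      then have "d/2 \<le> cmod (cis t - z)"
        using False elim norm_triangle_ineq4[of "cis t - z" "cis t0 - z"] by (simp add: dist_norm)
      then have "poisson_kernel z t \<le> K"
        using poisson_kernel_le[of "d/2" t z] d z by (simp add: K_def)
      moreover have "cmod (G (cis t) - G (cis t0)) \<le> 2"
        using norm_triangle_ineq4[of "G (cis t)" "G (cis t0)"] b[of t] b[of t0] by simp
      ultimately have "poisson_kernel z t * cmod (G (cis t) - G (cis t0)) \<le> K * 2"
        using K kn by (intro mult_mono) auto
      moreover have "0 \<le> poisson_kernel z t * (e/2)" using kn[of t] e by (intro mult_nonneg_nonneg) auto
      ultimately show ?thesis using kn[of t] by (simp add: norm_mult)
    qed
    have int1: "integrable circ (\<lambda>t. of_real (poisson_kernel z t) * G (cis t))"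
      by (rule integrable_poisson_kernel[OF z(2) m b])
    have intk: "integrable circ (\<lambda>t. complex_of_real (poisson_kernel z t))"
      using integrable_poisson_kernel[OF z(2), of "\<lambda>_. 1" 1] by simp
    have intk': "integrable circ (poisson_kernel z)" using integrable_Re[OF intk] by simp
    have "poisson_integral (\<lambda>t. G (cis t)) z - G (cis t0) =
        integral\<^sup>L circ (\<lambda>t. of_real (poisson_kernel z t) * (G (cis t) - G (cis t0)))"
      using int1 intk integral_poisson_kernel[OF z(2)]
      by (simp add: poisson_integral_eq right_diff_distrib Bochner_Integration.integral_diff)
    also have "cmod \<dots> \<le> integral\<^sup>L circ (\<lambda>t. cmod (of_real (poisson_kernel z t) * (G (cis t) - G (cis t0))))"
      by (rule integral_norm_bound)
    also have "\<dots> \<le> integral\<^sup>L circ (\<lambda>t. poisson_kernel z t * (e/2) + 2 * K)"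
    proof (rule integral_mono)
      show "integrable circ (\<lambda>t. cmod (of_real (poisson_kernel z t) * (G (cis t) - G (cis t0))))"
        using int1 intk by (intro integrable_norm) (simp add: right_diff_distrib)
      show "integrable circ (\<lambda>t. poisson_kernel z t * (e/2) + 2 * K)"
        using intk' by (intro Bochner_Integration.integrable_add integrable_mult_left) auto
    qed (rule bound)
    also have "\<dots> = e/2 + 2 * K"
      using intk' integral_poisson_kernel[OF z(2)] by (subst Bochner_Integration.integral_add) auto
    also have "\<dots> < e" using elim(1) unfolding K_def by linarith
    finally show ?case by (simp add: dist_norm z_def)
  qed
qed

section \<open>The extremal problem for one component\<close>

lemma integral_circ_cos_kernel:
  "integral\<^sup>L circ (\<lambda>t. cos (t - \<alpha>) / sqrt (l\<^sup>2 + (cos (t - \<alpha>))\<^sup>2)) = 0"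
proof (rule integral_circ_antiperiodic[where B = 1])
  show "\<bar>cos (t - \<alpha>) / sqrt (l\<^sup>2 + (cos (t - \<alpha>))\<^sup>2)\<bar> \<le> 1" for t
    using lam_kernel_le_1[of "cos (t - \<alpha>)" l] by (simp add: add.commute)
  show "cos (t + pi - \<alpha>) / sqrt (l\<^sup>2 + (cos (t + pi - \<alpha>))\<^sup>2) = - (cos (t - \<alpha>) / sqrt (l\<^sup>2 + (cos (t - \<alpha>))\<^sup>2))" for t
  proof -
    have "cos (t + pi - \<alpha>) = - cos (t - \<alpha>)"
      using cos_periodic_pi[of "t - \<alpha>"] by (simp add: algebra_simps)
    then show ?thesis by simp
  qed
qed measurable

lemma integrable_circ_cos_kernel:
  "integrable circ (\<lambda>t. cos (t - \<alpha>) / sqrt (l\<^sup>2 + (cos (t - \<alpha>))\<^sup>2))"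
proof (rule integrable_circ[where B = 1])
  show "norm (cos (t - \<alpha>) / sqrt (l\<^sup>2 + (cos (t - \<alpha>))\<^sup>2)) \<le> 1" for t
    using lam_kernel_le_1[of "cos (t - \<alpha>)" l] by (simp add: add.commute)
qed measurable

lemma integral_circ_shift_cos:
  fixes K :: "real \<Rightarrow> real"
  assumes "continuous_on UNIV K"
  shows "integral\<^sup>L circ (\<lambda>t. K (cos (t - \<alpha>))) = integral\<^sup>L circ (\<lambda>t. K (cos t))"
  by (rule integral_circ_shift[of "\<lambda>t. K (cos t)"])
    (auto intro!: continuous_on_compose2[OF assms] continuous_intros)

lemma integral_circ_shift_kernels:
  assumes "0 \<le> r" "r < 1"
  shows "integral\<^sup>L circ (\<lambda>t. sqrt ((lam0 r)\<^sup>2 + (cos (t - \<alpha>))\<^sup>2)) = lam0 r * r + MM r / 2"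
    and "integral\<^sup>L circ (\<lambda>t. lam0 r / sqrt ((lam0 r)\<^sup>2 + (cos (t - \<alpha>))\<^sup>2)) = r"
    and "integral\<^sup>L circ (\<lambda>t. (cos (t - \<alpha>))\<^sup>2 / sqrt ((lam0 r)\<^sup>2 + (cos (t - \<alpha>))\<^sup>2)) = MM r / 2"
proof -
  show "integral\<^sup>L circ (\<lambda>t. sqrt ((lam0 r)\<^sup>2 + (cos (t - \<alpha>))\<^sup>2)) = lam0 r * r + MM r / 2"
    unfolding sqrt_lam0_integral[OF assms, symmetric]
    by (rule integral_circ_shift_cos[of "\<lambda>x. sqrt ((lam0 r)\<^sup>2 + x\<^sup>2)"]) (intro continuous_intros)
  have pos: "sqrt ((lam0 r)\<^sup>2 + x\<^sup>2) \<noteq> 0" if "r \<noteq> 0" for x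
    using lam_pos_integral[of r] assms that by (auto simp: lam0_def add_nonneg_eq_0_iff)
  show "integral\<^sup>L circ (\<lambda>t. lam0 r / sqrt ((lam0 r)\<^sup>2 + (cos (t - \<alpha>))\<^sup>2)) = r"
  proof (cases "r = 0")
    case False
    have "integral\<^sup>L circ (\<lambda>t. lam0 r / sqrt ((lam0 r)\<^sup>2 + (cos (t - \<alpha>))\<^sup>2)) =
        integral\<^sup>L circ (\<lambda>t. lam0 r / sqrt ((lam0 r)\<^sup>2 + (cos t)\<^sup>2))"
      by (rule integral_circ_shift_cos[of "\<lambda>x. lam0 r / sqrt ((lam0 r)\<^sup>2 + x\<^sup>2)"])
        (intro continuous_intros ballI pos False)
    then show ?thesis using lam0_integral[OF assms] by simp
  qed (simp add: lam0_def)
  \<comment> \<open>For r = 0 the denominator vanishes at x = 0, but with x / 0 = 0 the quotient is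
    the absolute value of x, which is continuous.\<close>
  have "continuous_on UNIV (\<lambda>x. x\<^sup>2 / sqrt ((lam0 r)\<^sup>2 + x\<^sup>2))"
  proof (cases "r = 0")
    case True
    have "x\<^sup>2 / sqrt ((lam0 r)\<^sup>2 + x\<^sup>2) = \<bar>x\<bar>" for x
      using real_div_sqrt[of "x\<^sup>2"] True by (simp add: lam0_def)
    then show ?thesis by (simp add: continuous_on_rabs)
  qed (intro continuous_intros ballI pos)
  from integral_circ_shift_cos[OF this]
  show "integral\<^sup>L circ (\<lambda>t. (cos (t - \<alpha>))\<^sup>2 / sqrt ((lam0 r)\<^sup>2 + (cos (t - \<alpha>))\<^sup>2)) = MM r / 2"
    by (simp add: MM_eq)
qed

lemma norm_sq_combination:
  assumes "cmod c = 1" "cmod u = 1"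
  shows "(cmod (of_real l * c + u * of_real x))\<^sup>2 = l\<^sup>2 + x\<^sup>2 + 2 * l * x * Re (c * cnj u)"
proof -
  have "(Re c)\<^sup>2 + (Im c)\<^sup>2 = 1" "(Re u)\<^sup>2 + (Im u)\<^sup>2 = 1"
    using assms by (simp_all add: cmod_def)
  moreover have "(cmod (of_real l * c + u * of_real x))\<^sup>2 =
      l\<^sup>2 * ((Re c)\<^sup>2 + (Im c)\<^sup>2) + x\<^sup>2 * ((Re u)\<^sup>2 + (Im u)\<^sup>2) + 2 * l * x * Re (c * cnj u)"
    unfolding cmod_power2 by (simp add: power2_eq_square algebra_simps)
  ultimately show ?thesis by simp
qed

lemma harmonic_on_has_derivative: "harmonic_on f S \<Longrightarrow> z \<in> S \<Longrightarrow> \<exists>D. (f has_derivative D) (at z)"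
  unfolding harmonic_on_def by blast

text \<open>The Poisson formula for the dilate is evaluated at 0, then differentiated there in two
  ways: by the moment formula and by the chain rule. Uniqueness of the derivative gives the second
  equation.\<close>

lemma mean_dilate:
  assumes f: "harmonic_on f unit_disc" and b: "\<And>z. z \<in> unit_disc \<Longrightarrow> cmod (f z) \<le> 1"
    and D: "(f has_derivative D) (at 0)" and \<rho>: "0 \<le> \<rho>" "\<rho> < 1"
  shows "integral\<^sup>L circ (\<lambda>t. f (of_real \<rho> * cis t)) = f 0"
    and "2 * integral\<^sup>L circ (\<lambda>t. f (of_real \<rho> * cis t) * of_real (cos (t - \<alpha>))) = of_real \<rho> * D (cis \<alpha>)"
proof -
  let ?F = "\<lambda>t. f (of_real \<rho> * cis t)"
  have P: "poisson_integral ?F z = f (of_real \<rho> * z)" if "cmod z < 1" for z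
    by (rule poisson_formula_harmonic[OF f \<rho> that])
  have m: "?F \<in> borel_measurable borel"
    by (rule borel_measurable_continuous_onI, rule poisson_formula_harmonic[OF f \<rho>, of 0]) simp
  have bF: "cmod (?F t) \<le> 1" for t using b \<rho> by (simp add: norm_mult)
  show "integral\<^sup>L circ ?F = f 0" using P[of 0] poisson_integral_0[OF m] by simp
  obtain D' where D': "(poisson_integral ?F has_derivative D') (at 0)"
    "D' (cis \<alpha>) = 2 * integral\<^sup>L circ (\<lambda>t. ?F t * of_real (cos (t - \<alpha>)))"
    by (rule poisson_integral_has_derivative_0[OF m bF]) blast
  have "((\<lambda>z. of_real \<rho> * z) has_derivative (\<lambda>v. of_real \<rho> * v)) (at (0::complex))"
    by (auto intro!: derivative_eq_intros)
  from has_derivative_compose[OF this, of f D] D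
  have "((\<lambda>z. f (of_real \<rho> * z)) has_derivative (\<lambda>v. D (of_real \<rho> * v))) (at 0)" by simp
  then have "(poisson_integral ?F has_derivative (\<lambda>v. D (of_real \<rho> * v))) (at 0)"
    by (rule has_derivative_transform_within_open[of _ _ _ _ unit_disc]) (use P in auto)
  then have "D' = (\<lambda>v. D (of_real \<rho> * v))" by (rule has_derivative_unique[OF D'(1)])
  then have "D' (cis \<alpha>) = D (\<rho> *\<^sub>R cis \<alpha>)" by (simp add: scaleR_conv_of_real)
  also have "\<dots> = \<rho> *\<^sub>R D (cis \<alpha>)"
    using has_derivative_linear[OF D] by (rule linear_scale)
  finally show "2 * integral\<^sup>L circ (\<lambda>t. ?F t * of_real (cos (t - \<alpha>))) = of_real \<rho> * D (cis \<alpha>)"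
    using D'(2) by (simp add: scaleR_conv_of_real)
qed

text \<open>For |F| \<le> 1, expanding the square bounds |F - sgn w|^2 by 2 / |w| times the deficit:
  almost maximising Re (F * cnj w) forces F close to the unique maximiser.\<close>

lemma tendsto_sgn_if_deficit_0:
  fixes F :: "nat \<Rightarrow> complex"
  assumes F: "\<And>n. cmod (F n) \<le> 1" and w: "w \<noteq> 0"
    and lim: "(\<lambda>n. cmod w - Re (F n * cnj w)) \<longlonglongrightarrow> 0"
  shows "F \<longlonglongrightarrow> sgn w"
proof -
  have bound: "(cmod (F n - sgn w))\<^sup>2 \<le> 2 / cmod w * (cmod w - Re (F n * cnj w))" for n
  proof -
    have "(cmod (F n - sgn w))\<^sup>2 = (cmod (F n))\<^sup>2 + (cmod (sgn w))\<^sup>2 - 2 * Re (F n * cnj (sgn w))"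
      unfolding cmod_power2 by (simp add: power2_eq_square algebra_simps)
    moreover have "(cmod (F n))\<^sup>2 \<le> 1" using F by (simp add: power_le_one)
    moreover have "(cmod (sgn w))\<^sup>2 = 1" using w by (simp add: norm_sgn)
    moreover have "Re (F n * cnj (sgn w)) = Re (F n * cnj w) / cmod w"
      by (simp add: sgn_eq)
    moreover have "2 / cmod w * (cmod w - Re (F n * cnj w)) = 2 - 2 * (Re (F n * cnj w) / cmod w)"
      using w by (simp add: field_simps)
    ultimately show ?thesis by linarith
  qed
  have "(\<lambda>n. 2 / cmod w * (cmod w - Re (F n * cnj w))) \<longlonglongrightarrow> 2 / cmod w * 0"
    by (intro tendsto_intros lim)
  then have lim0: "(\<lambda>n. 2 / cmod w * (cmod w - Re (F n * cnj w))) \<longlonglongrightarrow> 0"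
    by (simp only: mult_zero_right)
  have "(\<lambda>n. (cmod (F n - sgn w))\<^sup>2) \<longlonglongrightarrow> 0"
    by (rule Lim_null_comparison[OF always_eventually lim0])
      (simp only: real_norm_def abs_of_nonneg zero_le_power2 bound simp_thms)
  from tendsto_real_sqrt[OF this] have "(\<lambda>n. cmod (F n - sgn w)) \<longlonglongrightarrow> 0" by simp
  then show ?thesis by (simp add: tendsto_norm_zero_iff LIM_zero_iff)
qed

text \<open>The phases \<open>c\<close> and \<open>u\<close> are parameters because a zero value has
  no distinguished phase, and because in the theorem the phase of f 0 is the given
  \<open>cis\<close> of an angle.\<close>

locale component =
  fixes f :: "complex \<Rightarrow> complex" and D :: "complex \<Rightarrow> complex" and r d \<alpha> :: real and c u :: complex
  assumes harmonic: "harmonic_on f unit_disc"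
    and f_le_1: "\<And>z. z \<in> unit_disc \<Longrightarrow> cmod (f z) \<le> 1"
    and deriv_0: "(f has_derivative D) (at 0)"
    and r: "0 \<le> r" "r < 1"
    and f_0: "f 0 = of_real r * c"
    and D_cis: "D (cis \<alpha>) = of_real d * u"
    and norm_c: "cmod c = 1" and norm_u: "cmod u = 1"
begin

definition w :: "real \<Rightarrow> complex" where
  "w t = of_real (lam0 r) * c + u * of_real (cos (t - \<alpha>))"

definition s :: "real \<Rightarrow> real" where
  "s t = sqrt ((lam0 r)\<^sup>2 + (cos (t - \<alpha>))\<^sup>2)"

text \<open>Half the coefficient of cos (t - \<alpha>) in |w|^2. It vanishes exactly when \<lambda>
  = 0 or u is orthogonal to c.\<close>

definition q :: real where "q = lam0 r * Re (c * cnj u)"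

text \<open>\<open>gap\<close> is the pointwise loss in the tangent line bound for |w|;
  \<open>deficit\<close> is the loss in Re (F * cnj w) \<le> |w| for the dilate F.\<close>

definition gap :: "real \<Rightarrow> real" where
  "gap t = s t + q * (cos (t - \<alpha>) / s t) - cmod (w t)"

definition deficit :: "real \<Rightarrow> real \<Rightarrow> real" where
  "deficit \<rho> t = cmod (w t) - Re (f (of_real \<rho> * cis t) * cnj (w t))"

lemma cont_w: "continuous_on UNIV w"
  unfolding w_def by (intro continuous_intros)

lemma measurable_w [measurable]: "w \<in> borel_measurable borel"
  by (rule borel_measurable_continuous_onI[OF cont_w])

lemma measurable_s [measurable]: "s \<in> borel_measurable borel"
  unfolding s_def by measurable

lemma norm_w_sq: "(cmod (w t))\<^sup>2 = (s t)\<^sup>2 + 2 * q * cos (t - \<alpha>)"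
  unfolding w_def norm_sq_combination[OF norm_c norm_u] s_def q_def by simp

lemma s_nonneg: "s t \<ge> 0" by (simp add: s_def)

lemma s_eq_0D: "s t = 0 \<Longrightarrow> lam0 r = 0 \<and> cos (t - \<alpha>) = 0"
  by (simp add: s_def add_nonneg_eq_0_iff)

text \<open>Completing the square, since 2 * q * cos (t - \<alpha>) = |w|^2 - s^2. Where s vanishes,
  w vanishes as well and both sides are 0.\<close>

lemma gap_eq: "gap t = (cmod (w t) - s t)\<^sup>2 / (2 * s t)"
proof (cases "s t = 0")
  case True
  with s_eq_0D[of t] have "w t = 0" by (simp add: w_def)
  with True show ?thesis by (simp add: gap_def)
next
  case False
  then show ?thesis
    using norm_w_sq[of t] by (simp add: gap_def field_simps power2_eq_square)
qed

lemma gap_nonneg: "gap t \<ge> 0"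
  unfolding gap_eq using s_nonneg by simp

lemma norm_w_le: "cmod (w t) \<le> \<bar>lam0 r\<bar> + 1"
proof -
  have "cmod (w t) \<le> \<bar>lam0 r\<bar> * cmod c + cmod u * \<bar>cos (t - \<alpha>)\<bar>"
    unfolding w_def by (rule order_trans[OF norm_triangle_ineq]) (simp add: norm_mult)
  also have "\<dots> \<le> \<bar>lam0 r\<bar> + 1" by (simp add: norm_c norm_u)
  finally show ?thesis .
qed

lemma integrable_norm_w: "integrable circ (\<lambda>t. cmod (w t))"
  by (rule integrable_circ[where B = "\<bar>lam0 r\<bar> + 1"]) (measurable, use norm_w_le in simp)

lemma s_le: "s t \<le> \<bar>lam0 r\<bar> + 1"
  unfolding s_def by (rule order_trans[OF sqrt_sum_squares_le_sum_abs]) simp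

lemma integrable_s: "integrable circ s"
  by (rule integrable_circ[where B = "\<bar>lam0 r\<bar> + 1"]) (measurable, use s_le s_nonneg in simp)

lemma integrable_gap: "integrable circ gap"
  unfolding gap_def
  by (intro Bochner_Integration.integrable_diff Bochner_Integration.integrable_add integrable_mult_right
      integrable_norm_w integrable_s) (unfold s_def, rule integrable_circ_cos_kernel)

lemma integral_gap: "integral\<^sup>L circ gap = lam0 r * r + MM r / 2 - integral\<^sup>L circ (\<lambda>t. cmod (w t))"
proof -
  have k: "integrable circ (\<lambda>t. cos (t - \<alpha>) / s t)" "integral\<^sup>L circ (\<lambda>t. cos (t - \<alpha>) / s t) = 0"
    unfolding s_def by (rule integrable_circ_cos_kernel integral_circ_cos_kernel)+
  have "integral\<^sup>L circ s = lam0 r * r + MM r / 2"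
    unfolding s_def by (rule integral_circ_shift_kernels(1)[OF r])
  moreover have "integral\<^sup>L circ gap = integral\<^sup>L circ (\<lambda>t. s t + q * (cos (t - \<alpha>) / s t)) - integral\<^sup>L circ (\<lambda>t. cmod (w t))"
    unfolding gap_def
    by (intro Bochner_Integration.integral_diff Bochner_Integration.integrable_add integrable_mult_right
        integrable_s integrable_norm_w k)
  moreover have "integral\<^sup>L circ (\<lambda>t. s t + q * (cos (t - \<alpha>) / s t)) = integral\<^sup>L circ s + q * 0"
    unfolding k(2)[symmetric] integral_mult_right_zero[symmetric]
    by (intro Bochner_Integration.integral_add integrable_mult_right integrable_s k)
  ultimately show ?thesis by simp
qed

context
  fixes \<rho> :: real
  assumes \<rho>: "0 \<le> \<rho>" "\<rho> < 1"
begin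

lemma measurable_dilate [measurable]: "(\<lambda>t. f (of_real \<rho> * cis t)) \<in> borel_measurable borel"
  by (rule borel_measurable_continuous_onI, rule poisson_formula_harmonic[OF harmonic \<rho>, of 0]) simp

lemma dilate_le_1: "cmod (f (of_real \<rho> * cis t)) \<le> 1"
  using f_le_1 \<rho> by (simp add: norm_mult)

lemma deficit_nonneg: "deficit \<rho> t \<ge> 0"
proof -
  have "Re (f (of_real \<rho> * cis t) * cnj (w t)) \<le> cmod (f (of_real \<rho> * cis t)) * cmod (w t)"
    using complex_Re_le_cmod[of "f (of_real \<rho> * cis t) * cnj (w t)"] by (simp add: norm_mult)
  also have "\<dots> \<le> 1 * cmod (w t)" by (intro mult_right_mono dilate_le_1) simp
  finally show ?thesis by (simp add: deficit_def)
qed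

lemma integrable_dilate: "integrable circ (\<lambda>t. f (of_real \<rho> * cis t) * of_real (g t))"
  if [measurable]: "g \<in> borel_measurable borel" and g: "\<And>t. \<bar>g t\<bar> \<le> 1" for g :: "real \<Rightarrow> real"
proof (rule integrable_circ[where B = 1])
  show "cmod (f (of_real \<rho> * cis t) * of_real (g t)) \<le> 1" for t
    unfolding norm_mult using mult_mono[OF dilate_le_1[of t] g[of t]] by simp
qed measurable

lemma dilate_mult_cnj_w:
  "has_bochner_integral circ (\<lambda>t. f (of_real \<rho> * cis t) * cnj (w t)) (of_real (lam0 r * r + \<rho> * d / 2))"
proof -
  let ?F = "\<lambda>t. f (of_real \<rho> * cis t)"
  have 1: "integrable circ ?F" using integrable_dilate[of "\<lambda>_. 1"] by simp
  have 2: "integrable circ (\<lambda>t. ?F t * of_real (cos (t - \<alpha>)))"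
    by (rule integrable_dilate) auto
  have 0: "integral\<^sup>L circ ?F = of_real r * c"
    using mean_dilate(1)[OF harmonic f_le_1 deriv_0 \<rho>] by (simp add: f_0)
  have 3: "integral\<^sup>L circ (\<lambda>t. ?F t * of_real (cos (t - \<alpha>))) = of_real (\<rho> * d / 2) * u"
    using mean_dilate(2)[OF harmonic f_le_1 deriv_0 \<rho>, of \<alpha>] by (simp add: D_cis field_simps)
  have cc: "cnj c * c = 1" "cnj u * u = 1"
    using complex_norm_square[of c] complex_norm_square[of u] norm_c norm_u by (simp_all add: mult.commute)
  have "has_bochner_integral circ (\<lambda>t. of_real (lam0 r) * cnj c * ?F t + cnj u * (?F t * of_real (cos (t - \<alpha>))))
     (of_real (lam0 r) * cnj c * (of_real r * c) + cnj u * (of_real (\<rho> * d / 2) * u))"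
    using has_bochner_integral_integrable[OF 1, unfolded 0] has_bochner_integral_integrable[OF 2, unfolded 3]
    by (intro has_bochner_integral_add has_bochner_integral_mult_right)
  moreover have "of_real (lam0 r) * cnj c * (of_real r * c) + cnj u * (of_real (\<rho> * d / 2) * u) =
      of_real (lam0 r * r) * (cnj c * c) + of_real (\<rho> * d / 2) * (cnj u * u)"
    by (simp add: mult_ac)
  moreover have "(\<lambda>t. of_real (lam0 r) * cnj c * ?F t + cnj u * (?F t * of_real (cos (t - \<alpha>)))) = (\<lambda>t. ?F t * cnj (w t))"
    by (auto simp: w_def algebra_simps)
  ultimately show ?thesis unfolding cc by simp
qed

lemma deficit_integral:
  "has_bochner_integral circ (deficit \<rho>) (integral\<^sup>L circ (\<lambda>t. cmod (w t)) - (lam0 r * r + \<rho> * d / 2))"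
  unfolding deficit_def
  using has_bochner_integral_diff[OF has_bochner_integral_integrable[OF integrable_norm_w]
      has_bochner_integral_Re[OF dilate_mult_cnj_w]] by simp

text \<open>The mean of |w|, which depends on u, cancels and is never evaluated. Both terms being
  nonnegative, d = \<open>MM r\<close> forces each to 0 as \<rho> tends to 1.\<close>

lemma integral_gap_add_deficit:
  "integral\<^sup>L circ gap + integral\<^sup>L circ (deficit \<rho>) = (MM r - \<rho> * d) / 2"
  using has_bochner_integral_integral_eq[OF deficit_integral] integral_gap by (simp add: field_simps)

lemma integral_gap_deficit_nonneg: "integral\<^sup>L circ gap \<ge> 0" "integral\<^sup>L circ (deficit \<rho>) \<ge> 0"
  using gap_nonneg deficit_nonneg by (auto intro: Bochner_Integration.integral_nonneg)

end

lemma derivative_le: "d \<le> MM r"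
proof (rule ccontr)
  assume "\<not> d \<le> MM r"
  then have d: "MM r < d" by simp
  then have "d > 0" using MM_nonneg[of r] by linarith
  with d have "MM r / d < 1" by simp
  then obtain \<rho> where \<rho>: "MM r / d < \<rho>" "\<rho> < 1" using dense by blast
  have "\<rho> \<ge> 0" using \<rho> MM_nonneg[of r] \<open>d > 0\<close> by (meson divide_nonneg_pos less_imp_le order_trans)
  then have "0 \<le> (MM r - \<rho> * d) / 2"
    using integral_gap_add_deficit[of \<rho>] integral_gap_deficit_nonneg[of \<rho>] \<rho> by simp
  moreover have "MM r < \<rho> * d" using \<rho> \<open>d > 0\<close> by (simp add: divide_less_eq)
  ultimately show False by simp
qed

context
  assumes extremal: "d = MM r"
begin

text \<open>Radii along a sequence: convergence of the deficits in mean gives almost everywhere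
  convergence only along a subsequence.\<close>

definition radius :: "nat \<Rightarrow> real" where "radius n = 1 - inverse (real (Suc n))"

lemma radius: "0 \<le> radius n" "radius n < 1"
  by (auto simp: radius_def inverse_le_1_iff)

lemma radius_lim: "radius \<longlonglongrightarrow> 1"
  unfolding radius_def using tendsto_diff[OF tendsto_const LIMSEQ_inverse_real_of_nat, of 1] by simp

lemma integral_gap_0: "integral\<^sup>L circ gap = 0"
proof -
  have "(\<lambda>n. (MM r - radius n * d) / 2) \<longlonglongrightarrow> (MM r - 1 * d) / 2"
    by (intro tendsto_intros radius_lim) simp
  moreover have "integral\<^sup>L circ gap \<le> (MM r - radius n * d) / 2" for n
    using integral_gap_add_deficit[OF radius, of n] integral_gap_deficit_nonneg(2)[OF radius, of n] by linarith
  ultimately have "integral\<^sup>L circ gap \<le> (MM r - 1 * d) / 2"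
    by (intro LIMSEQ_le_const) auto
  with integral_gap_deficit_nonneg(1)[of 0] show ?thesis by (simp add: extremal)
qed

text \<open>The gap does not involve \<rho>, so its mean is 0 and |w| = s almost everywhere. The
  cross term 2 * q * cos then vanishes at an angle where the cosine does not.\<close>

lemma q_eq_0: "q = 0"
proof (rule ccontr)
  assume q: "q \<noteq> 0"
  have "AE t in circ. gap t = 0"
    using integral_gap_0 integrable_gap gap_nonneg by (simp add: integral_nonneg_eq_0_iff_AE)
  with AE_circ[OF AE_cos_nonzero[of \<alpha>]] have "AE t in circ. False"
  proof eventually_elim
    case (elim t)
    have "s t \<noteq> 0" using s_eq_0D[of t] elim by auto
    with elim have "cmod (w t) = s t" by (simp add: gap_eq)
    with norm_w_sq[of t] elim q show False by simp
  qed
  with AE_circ_False show False by simp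
qed

text \<open>A subsequence of radii suffices: in the Poisson formula for the dilates, one side tends
  to f z by continuity inside the disc, the other to the Poisson integral of sgn w by dominated
  convergence.\<close>

lemma eq_poisson_integral:
  assumes z: "z \<in> unit_disc"
  shows "f z = poisson_integral (\<lambda>t. sgn (w t)) z"
proof -
  have w_nz: "w t \<noteq> 0" if "cos (t - \<alpha>) \<noteq> 0" for t
    using norm_w_sq[of t] s_eq_0D[of t] that by (auto simp: q_eq_0)
  have int: "integral\<^sup>L circ (deficit (radius n)) = (MM r - radius n * d) / 2" for n
    using integral_gap_add_deficit[OF radius, of n] integral_gap_0 by simp
  have "(\<lambda>n. (MM r - radius n * d) / 2) \<longlonglongrightarrow> (MM r - 1 * d) / 2"
    by (intro tendsto_intros radius_lim) simp
  moreover have "(\<integral>t. norm (deficit (radius n) t) \<partial>circ) = (MM r - radius n * d) / 2" for n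
    unfolding int[symmetric] using deficit_nonneg[OF radius] by simp
  ultimately have "(\<lambda>n. \<integral>t. norm (deficit (radius n) t) \<partial>circ) \<longlonglongrightarrow> 0"
    by (simp only: extremal) simp
  then obtain k where k: "strict_mono k" and ae: "AE t in circ. (\<lambda>n. deficit (radius (k n)) t) \<longlonglongrightarrow> 0"
    using tendsto_L1_AE_subseq[of circ "\<lambda>n. deficit (radius n)"]
      has_bochner_integral_iff[THEN iffD1, OF deficit_integral[OF radius]] by blast
  have lim: "AE t in circ. (\<lambda>n. f (of_real (radius (k n)) * cis t)) \<longlonglongrightarrow> sgn (w t)"
    using ae AE_circ[OF AE_cos_nonzero[of \<alpha>]]
  proof eventually_elim
    case (elim t)
    show ?case
      by (rule tendsto_sgn_if_deficit_0) (use elim w_nz dilate_le_1[OF radius] in \<open>auto simp: deficit_def\<close>)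
  qed
  have z1: "cmod z < 1" using z by simp
  define C where "C = (1 - (cmod z)\<^sup>2) / (1 - cmod z)\<^sup>2"
  have pk: "\<bar>poisson_kernel z t\<bar> \<le> C" for t
    using poisson_kernel_le[of "1 - cmod z" t z] cmod_cis_minus_ge[of z t] poisson_kernel_pos[of z t] z1
    by (simp add: C_def)
  have "(\<lambda>n. integral\<^sup>L circ (\<lambda>t. of_real (poisson_kernel z t) * f (of_real (radius (k n)) * cis t)))
      \<longlonglongrightarrow> integral\<^sup>L circ (\<lambda>t. of_real (poisson_kernel z t) * sgn (w t))"
  proof (rule integral_dominated_convergence[where w = "\<lambda>_. C"])
    show "AE t in circ. (\<lambda>n. of_real (poisson_kernel z t) * f (of_real (radius (k n)) * cis t))
        \<longlonglongrightarrow> of_real (poisson_kernel z t) * sgn (w t)"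
      using lim by eventually_elim (intro tendsto_intros)
    show "AE t in circ. norm (of_real (poisson_kernel z t) * f (of_real (radius (k n)) * cis t)) \<le> C" for n
    proof (rule AE_I2)
      fix t
      have "\<bar>poisson_kernel z t\<bar> * cmod (f (of_real (radius (k n)) * cis t)) \<le> C * 1"
        using pk[of t] dilate_le_1[OF radius] by (intro mult_mono) (auto intro: order_trans[OF abs_ge_zero])
      then show "norm (of_real (poisson_kernel z t) * f (of_real (radius (k n)) * cis t)) \<le> C"
        by (simp add: norm_mult)
    qed
    show "(\<lambda>t. of_real (poisson_kernel z t) * f (of_real (radius (k n)) * cis t)) \<in> borel_measurable circ" for n
      using measurable_dilate[OF radius, of "k n"] by simp
  qed simp_all
  moreover have "integral\<^sup>L circ (\<lambda>t. of_real (poisson_kernel z t) * f (of_real (radius (k n)) * cis t)) =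
      f (of_real (radius (k n)) * z)" for n
    using poisson_formula_harmonic(2)[OF harmonic radius z1, of "k n"]
    by (simp add: poisson_integral_eq[OF measurable_dilate[OF radius]])
  ultimately have "(\<lambda>n. f (of_real (radius (k n)) * z)) \<longlonglongrightarrow> poisson_integral (\<lambda>t. sgn (w t)) z"
    by (simp add: poisson_integral_eq)
  moreover have "(\<lambda>n. f (of_real (radius (k n)) * z)) \<longlonglongrightarrow> f z"
  proof -
    have "isCont f z"
      using harmonic_on_has_derivative[OF harmonic z] has_derivative_continuous by blast
    moreover have "(\<lambda>n. of_real (radius (k n)) * z) \<longlonglongrightarrow> of_real 1 * z"
      using LIMSEQ_subseq_LIMSEQ[OF radius_lim k] by (intro tendsto_intros) (simp add: o_def)
    ultimately show ?thesis using isCont_tendsto_compose[of z f] by simp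
  qed
  ultimately show ?thesis by (rule LIMSEQ_unique[symmetric])
qed

end

end

section \<open>Extremal boundary functions\<close>

text \<open>Covers both boundary functions of the theorem; \<open>sgn\<close> is the complex sign \<open>z / cmod z\<close>,
  with value 0 at 0.\<close>

definition extremal_boundary :: "real \<Rightarrow> complex \<Rightarrow> complex \<Rightarrow> real \<Rightarrow> real \<Rightarrow> complex" where
  "extremal_boundary r c u \<alpha> t = sgn (of_real (lam0 r) * c + u * of_real (cos (t - \<alpha>)))"

lemma measurable_extremal_boundary [measurable]:
  "extremal_boundary r c u \<alpha> \<in> borel_measurable borel"
proof -
  have "(\<lambda>t. of_real (lam0 r) * c + u * of_real (cos (t - \<alpha>))) \<in> borel_measurable borel"
    by measurable
  then show ?thesis
    unfolding extremal_boundary_def sgn_eq by measurable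
qed

lemma norm_extremal_boundary_le: "cmod (extremal_boundary r c u \<alpha> t) \<le> 1"
  by (simp add: extremal_boundary_def norm_sgn)

lemma bdry_nonzero_eq:
  assumes "0 < r" "\<sigma> \<in> {-1, 1}"
  shows "bdry_nonzero r \<beta> \<sigma> \<alpha> = extremal_boundary r (cis \<beta>) (\<i> * of_real \<sigma> * cis \<beta>) \<alpha>"
proof
  fix t
  let ?w = "cis \<beta> * (of_real (lam r) + \<i> * of_real (\<sigma> * cos (t - \<alpha>)))"
  have "cmod ?w = cmod (Complex (lam r) (\<sigma> * cos (t - \<alpha>)))"
    unfolding norm_mult by (simp add: Complex_eq)
  also have "\<dots> = sqrt ((lam r)\<^sup>2 + (cos (t - \<alpha>))\<^sup>2)"
    using assms by (auto simp: cmod_def power_mult_distrib)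
  finally have "bdry_nonzero r \<beta> \<sigma> \<alpha> t = sgn ?w"
    by (simp add: bdry_nonzero_def sgn_eq)
  also have "?w = of_real (lam0 r) * cis \<beta> + \<i> * of_real \<sigma> * cis \<beta> * of_real (cos (t - \<alpha>))"
    using assms by (simp add: lam0_def algebra_simps)
  finally show "bdry_nonzero r \<beta> \<sigma> \<alpha> t = extremal_boundary r (cis \<beta>) (\<i> * of_real \<sigma> * cis \<beta>) \<alpha> t"
    unfolding extremal_boundary_def .
qed

lemma bdry_zero_eq:
  assumes "cmod \<omega> = 1"
  shows "bdry_zero \<omega> \<alpha> = extremal_boundary 0 c \<omega> \<alpha>"
  using assms by (auto simp: fun_eq_iff bdry_zero_def extremal_boundary_def lam0_def sgn_mult sgn_of_real sgn_eq[of \<omega>])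

lemma norm_combination:
  assumes "cmod c = 1" "cmod u = 1" "lam0 r * Re (c * cnj u) = 0"
  shows "cmod (of_real (lam0 r) * c + u * of_real (cos (t - \<alpha>))) = sqrt ((lam0 r)\<^sup>2 + (cos (t - \<alpha>))\<^sup>2)"
proof -
  have "2 * lam0 r * cos (t - \<alpha>) * Re (c * cnj u) = 0"
    using assms(3) by auto
  then have "(cmod (of_real (lam0 r) * c + u * of_real (cos (t - \<alpha>))))\<^sup>2 = (lam0 r)\<^sup>2 + (cos (t - \<alpha>))\<^sup>2"
    using norm_sq_combination[OF assms(1,2), of "lam0 r" "cos (t - \<alpha>)"] by simp
  then show ?thesis by (metis norm_ge_zero real_sqrt_unique)
qed

lemma norm_extremal_boundary:
  assumes "cmod c = 1" "cmod u = 1" "lam0 r * Re (c * cnj u) = 0" "cos (t - \<alpha>) \<noteq> 0"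
  shows "cmod (extremal_boundary r c u \<alpha> t) = 1"
proof -
  have "cmod (of_real (lam0 r) * c + u * of_real (cos (t - \<alpha>))) \<noteq> 0"
    unfolding norm_combination[OF assms(1-3)] using assms(4) by (simp add: add_nonneg_eq_0_iff)
  then show ?thesis by (simp add: extremal_boundary_def norm_sgn)
qed

text \<open>Orthogonality gives |w| = s, so the function is c * \<lambda> / s + u * cos / s. The
  means of \<lambda> / s, cos / s and cos^2 / s are r, 0 and half of \<open>MM r\<close>.\<close>

lemma extremal_boundary_integrals:
  assumes cu: "cmod c = 1" "cmod u = 1" "lam0 r * Re (c * cnj u) = 0" and r: "0 \<le> r" "r < 1"
  shows "integral\<^sup>L circ (extremal_boundary r c u \<alpha>) = of_real r * c"
    and "integral\<^sup>L circ (\<lambda>t. extremal_boundary r c u \<alpha> t * of_real (cos (t - \<alpha>))) = of_real (MM r / 2) * u"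
proof -
  let ?s = "\<lambda>t. sqrt ((lam0 r)\<^sup>2 + (cos (t - \<alpha>))\<^sup>2)"
  let ?A = "\<lambda>t. lam0 r / ?s t" and ?B = "\<lambda>t. cos (t - \<alpha>) / ?s t" and ?C = "\<lambda>t. (cos (t - \<alpha>))\<^sup>2 / ?s t"
  have eb: "extremal_boundary r c u \<alpha> t = c * of_real (?A t) + u * of_real (?B t)" for t
    unfolding extremal_boundary_def sgn_eq norm_combination[OF cu] by (simp add: add_divide_distrib mult.commute)
  have ebc: "extremal_boundary r c u \<alpha> t * of_real (cos (t - \<alpha>)) = c * of_real (lam0 r) * of_real (?B t) + u * of_real (?C t)" for t
    unfolding eb by (simp add: algebra_simps power2_eq_square)
  have A: "integrable circ (\<lambda>t. complex_of_real (?A t))"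
    by (rule integrable_circ[where B = 1]) (measurable, unfold norm_of_real, rule lam_kernel_le_1)
  have B: "integrable circ (\<lambda>t. complex_of_real (?B t))"
    using integrable_circ_cos_kernel by (rule integrable_of_real)
  have C: "integrable circ (\<lambda>t. complex_of_real (?C t))"
    by (rule integrable_circ[where B = 1]) (measurable, unfold norm_of_real, rule cos_kernel_le_1)
  have "integral\<^sup>L circ (extremal_boundary r c u \<alpha>) =
      integral\<^sup>L circ (\<lambda>t. c * of_real (?A t)) + integral\<^sup>L circ (\<lambda>t. u * of_real (?B t))"
    unfolding eb by (intro Bochner_Integration.integral_add integrable_mult_right A B)
  also have "\<dots> = c * of_real r + u * of_real 0"
    unfolding integral_mult_right_zero integral_complex_of_real integral_circ_shift_kernels[OF r] integral_circ_cos_kernel ..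
  finally show "integral\<^sup>L circ (extremal_boundary r c u \<alpha>) = of_real r * c" by (simp add: mult.commute)
  have "integral\<^sup>L circ (\<lambda>t. extremal_boundary r c u \<alpha> t * of_real (cos (t - \<alpha>))) =
      integral\<^sup>L circ (\<lambda>t. c * of_real (lam0 r) * of_real (?B t)) + integral\<^sup>L circ (\<lambda>t. u * of_real (?C t))"
    unfolding ebc by (intro Bochner_Integration.integral_add integrable_mult_right B C)
  also have "\<dots> = c * of_real (lam0 r) * of_real 0 + u * of_real (MM r / 2)"
    unfolding integral_mult_right_zero integral_complex_of_real integral_circ_shift_kernels[OF r] integral_circ_cos_kernel ..
  finally show "integral\<^sup>L circ (\<lambda>t. extremal_boundary r c u \<alpha> t * of_real (cos (t - \<alpha>))) = of_real (MM r / 2) * u"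
    by (simp add: mult.commute)
qed

lemma poisson_extremal_boundary_radial_limit:
  assumes cu: "cmod c = 1" "cmod u = 1" "lam0 r * Re (c * cnj u) = 0" and cos: "cos (t - \<alpha>) \<noteq> 0"
  shows "has_radial_limit (poisson_integral (extremal_boundary r c u \<alpha>)) t (extremal_boundary r c u \<alpha> t)"
proof -
  \<comment> \<open>On the circle Re (\<zeta> * cis (- \<alpha>)) is cos (t - \<alpha>); this
    extends the boundary function to the plane.\<close>
  define G where "G \<zeta> = sgn (of_real (lam0 r) * c + u * of_real (Re (\<zeta> * cis (- \<alpha>))))" for \<zeta>
  have G: "G (cis t) = extremal_boundary r c u \<alpha> t" for t
    unfolding G_def extremal_boundary_def cis_mult by simp
  have "of_real (lam0 r) * c + u * of_real (Re (cis t * cis (- \<alpha>))) \<noteq> 0"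
    using norm_extremal_boundary[OF cu cos] unfolding G[symmetric] G_def by auto
  then have "isCont G (cis t)"
    unfolding G_def
    by (intro isCont_sgn continuous_add continuous_mult continuous_const continuous_of_real
        bounded_linear.continuous[OF bounded_linear_Re] continuous_ident)
  from poisson_integral_radial_limit[OF _ _ this] show ?thesis
    unfolding G by (simp add: norm_extremal_boundary_le)
qed

lemma has_radial_limit_cong:
  assumes "has_radial_limit g t a" and eq: "\<And>z. z \<in> unit_disc \<Longrightarrow> f z = g z"
  shows "has_radial_limit f t a"
proof -
  have "\<forall>\<^sub>F \<rho> in at_left 1. g (of_real \<rho> * cis t) = f (of_real \<rho> * cis t)"
    by (rule eventually_at_leftI[of 0]) (auto simp: eq norm_mult)
  then show ?thesis
    using assms(1) unfolding has_radial_limit_def by (rule Lim_transform_eventually[rotated])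
qed

section \<open>From one component to the polydisc\<close>

lemma harmonic_derivative_le:
  assumes "harmonic_on f unit_disc" "\<And>z. z \<in> unit_disc \<Longrightarrow> cmod (f z) \<le> 1"
    "(f has_derivative D) (at 0)" "cmod (f 0) < 1"
  shows "cmod (D (cis \<alpha>)) \<le> MM (cmod (f 0))"
proof -
  have polar: "\<exists>v. cmod v = 1 \<and> z = of_real (cmod z) * v" for z
    using rcis_cmod_Arg[of z] unfolding rcis_def by (metis norm_cis)
  obtain c u where cu: "cmod c = 1" "f 0 = of_real (cmod (f 0)) * c"
    "cmod u = 1" "D (cis \<alpha>) = of_real (cmod (D (cis \<alpha>))) * u"
    using polar by metis
  interpret component f D "cmod (f 0)" "cmod (D (cis \<alpha>))" \<alpha> c u
    by unfold_locales (use assms cu in auto)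
  show ?thesis by (rule derivative_le)
qed

lemma harmonic_derivative_eq_imp:
  assumes f: "harmonic_on f unit_disc" "\<And>z. z \<in> unit_disc \<Longrightarrow> cmod (f z) \<le> 1"
    "(f has_derivative D) (at 0)" "f 0 = of_real r * c" "cmod c = 1" "0 \<le> r" "r < 1"
    and eq: "cmod (D (cis \<alpha>)) = MM r"
  obtains u where "cmod u = 1" "lam0 r * Re (c * cnj u) = 0"
    "\<And>t. cos (t - \<alpha>) \<noteq> 0 \<Longrightarrow> has_radial_limit f t (extremal_boundary r c u \<alpha> t)"
proof -
  obtain u where u: "cmod u = 1" "D (cis \<alpha>) = of_real (cmod (D (cis \<alpha>))) * u"
    using rcis_cmod_Arg[of "D (cis \<alpha>)"] unfolding rcis_def by (metis norm_cis)
  interpret component f D r "cmod (D (cis \<alpha>))" \<alpha> c u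
    by unfold_locales (use assms u in auto)
  have q0: "lam0 r * Re (c * cnj u) = 0" using q_eq_0[OF eq] by (simp add: q_def)
  have fP: "f z = poisson_integral (extremal_boundary r c u \<alpha>) z" if "z \<in> unit_disc" for z
    using eq_poisson_integral[OF eq that] unfolding w_def extremal_boundary_def[symmetric] .
  show ?thesis
    by (rule that[OF u(1) q0], rule has_radial_limit_cong[OF poisson_extremal_boundary_radial_limit])
      (use u q0 fP assms in auto)
qed

text \<open>Compactness of the unit circle and homogeneity. An attained direction is needed so that
  all components can be compared at one and the same \<alpha>.\<close>

lemma onorm_attained_cis:
  fixes D :: "complex \<Rightarrow> 'b::real_normed_vector"
  assumes "bounded_linear D"
  obtains \<alpha> where "onorm D = norm (D (cis \<alpha>))"
proof -
  interpret bounded_linear D by fact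
  have "continuous_on (sphere 0 1) (\<lambda>x. norm (D x))"
    by (intro continuous_intros linear_continuous_on assms)
  then obtain x where x: "x \<in> sphere 0 1" and max: "\<And>y. y \<in> sphere 0 1 \<Longrightarrow> norm (D y) \<le> norm (D x)"
    using continuous_attains_sup[of "sphere 0 1 :: complex set" "\<lambda>x. norm (D x)"] by auto
  have "onorm D \<le> norm (D x)"
  proof (rule onorm_bound)
    fix y
    show "norm (D y) \<le> norm (D x) * norm y"
    proof (cases "y = 0")
      case False
      have "D y = norm y *\<^sub>R D (sgn y)"
        unfolding scaleR[symmetric] by (simp add: sgn_div_norm False)
      moreover have "norm (D (sgn y)) \<le> norm (D x)"
        using False by (intro max) (simp add: norm_sgn)
      ultimately show ?thesis using mult_left_mono[of "norm (D (sgn y))" "norm (D x)" "norm y"] by (simp add: mult.commute)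
    qed (simp add: zero)
  qed simp
  moreover have "norm (D x) \<le> onorm D"
    using onorm[OF assms, of x] x by simp
  moreover have "x = cis (Arg x)"
    using rcis_cmod_Arg[of x] x by (simp add: rcis_def)
  ultimately have "onorm D = norm (D (cis (Arg x)))" by simp
  then show ?thesis by (rule that)
qed

lemma bounded_linear_axis: "bounded_linear (axis j :: 'a::real_normed_vector \<Rightarrow> 'a ^ 'n)"
proof (rule bounded_linear_intro[where K = 1])
  fix x :: 'a
  have "(norm (axis j x $ i))\<^sup>2 = (if i = j then (norm x)\<^sup>2 else 0)" for i :: 'n
    by (simp add: axis_def)
  then show "norm (axis j x :: 'a ^ 'n) \<le> norm x * 1"
    by (simp add: norm_vec_def L2_set_def)
qed (auto simp: axis_def vec_eq_iff)

lemma has_derivative_vec_lambda: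
  fixes F :: "'a::real_normed_vector \<Rightarrow> 'b::real_normed_vector ^ 'n"
  assumes "\<And>j. ((\<lambda>z. F z $ j) has_derivative D j) (at x)"
  shows "(F has_derivative (\<lambda>h. \<chi> j. D j h)) (at x)"
proof -
  have sum: "v = (\<Sum>j\<in>UNIV. axis j (v $ j))" for v :: "'b ^ 'n"
    by (simp add: vec_eq_iff axis_def if_distrib cong: if_cong)
  have "((\<lambda>z. \<Sum>j\<in>UNIV. axis j (F z $ j)) has_derivative (\<lambda>h. \<Sum>j\<in>UNIV. axis j (D j h))) (at x)"
    by (intro has_derivative_sum bounded_linear.has_derivative[OF bounded_linear_axis] assms)
  moreover have "(\<Sum>j\<in>UNIV. axis j (D j h)) = (\<chi> j. D j h)" for h
    using sum[of "\<chi> j. D j h"] by simp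
  ultimately show ?thesis by (simp add: sum[symmetric])
qed

lemma extremal_component_directions:
  fixes p :: "complex ^ 'n"
  assumes p: "\<And>j. p $ j \<in> unit_disc" and F: "extremal_at p F"
  obtains \<alpha> D where "\<And>j. ((\<lambda>z. F z $ j) has_derivative D j) (at 0)"
    "\<And>j. cmod (D j (cis \<alpha>)) = MM (cmod (p $ j))"
proof -
  have harm: "harmonic_on (\<lambda>z. F z $ j) unit_disc" and disc: "z \<in> unit_disc \<Longrightarrow> F z $ j \<in> unit_disc"
    and F0: "F 0 = p" for j z
    using F by (auto simp: extremal_at_def harmonic_polydisc_map_def)
  have "\<exists>D. \<forall>j. ((\<lambda>z. F z $ j) has_derivative D j) (at 0)"
    using harmonic_on_has_derivative[OF harm, of 0] by (intro choice) simp
  then obtain D where D: "\<And>j. ((\<lambda>z. F z $ j) has_derivative D j) (at 0)" by blast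
  let ?D = "\<lambda>h. \<chi> j. D j h"
  have DF: "(F has_derivative ?D) (at 0)" by (rule has_derivative_vec_lambda[OF D])
  then have "frechet_derivative F (at 0) = ?D" by (rule frechet_derivative_at[symmetric])
  with F have on: "onorm ?D = sqrt (\<Sum>j\<in>UNIV. (MM (cmod (p $ j)))\<^sup>2)" by (simp add: extremal_at_def)
  obtain \<alpha> where "onorm ?D = norm (?D (cis \<alpha>))"
    by (rule onorm_attained_cis[OF has_derivative_bounded_linear[OF DF]])
  with on have sum: "(\<Sum>j\<in>UNIV. (cmod (D j (cis \<alpha>)))\<^sup>2) = (\<Sum>j\<in>UNIV. (MM (cmod (p $ j)))\<^sup>2)"
    by (simp add: norm_vec_def L2_set_def)
  have le: "cmod (D j (cis \<alpha>)) \<le> MM (cmod (p $ j))" for j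
    using harmonic_derivative_le[OF harm _ D, of j \<alpha>] disc p[of j] by (simp add: F0 less_imp_le)
  have "(cmod (D j (cis \<alpha>)))\<^sup>2 = (MM (cmod (p $ j)))\<^sup>2" for j
    by (rule sum_mono_inv[OF sum]) (auto intro!: power_mono le)
  then have "cmod (D j (cis \<alpha>)) = MM (cmod (p $ j))" for j
    by (rule power2_eq_imp_eq) (auto simp: MM_nonneg)
  with D show ?thesis by (rule that)
qed

text \<open>In direction \<alpha> all components attain their maximal derivatives at once, which
  bounds the operator norm from below; \<open>harmonic_derivative_le\<close> in every direction
  bounds it from above.\<close>

lemma extremal_at_poisson_extremal_boundary:
  fixes p c u :: "complex ^ 'n"
  assumes p: "\<And>j. p $ j \<in> unit_disc" "\<And>j. p $ j = of_real (cmod (p $ j)) * c $ j"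
    and cu: "\<And>j. cmod (c $ j) = 1" "\<And>j. cmod (u $ j) = 1"
      "\<And>j. lam0 (cmod (p $ j)) * Re (c $ j * cnj (u $ j)) = 0"
  shows "extremal_at p (\<lambda>z. \<chi> j. poisson_integral (extremal_boundary (cmod (p $ j)) (c $ j) (u $ j) \<alpha>) z)"
proof -
  define \<phi> where "\<phi> j = extremal_boundary (cmod (p $ j)) (c $ j) (u $ j) \<alpha>" for j
  have m: "\<phi> j \<in> borel_measurable borel" and b: "cmod (\<phi> j t) \<le> 1" for j t
    unfolding \<phi>_def by (simp_all add: norm_extremal_boundary_le)
  have mean: "integral\<^sup>L circ (\<phi> j) = p $ j"
    and mean_cos: "integral\<^sup>L circ (\<lambda>t. \<phi> j t * of_real (cos (t - \<alpha>))) = of_real (MM (cmod (p $ j)) / 2) * u $ j" for j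
    unfolding \<phi>_def using extremal_boundary_integrals[OF cu(1)[of j] cu(2)[of j] cu(3)[of j], of \<alpha>] p[of j] by auto
  have harm: "harmonic_on (poisson_integral (\<phi> j)) unit_disc" for j
    by (rule poisson_integral_harmonic[OF m b])
  have less: "cmod (poisson_integral (\<phi> j) z) < 1" if "cmod z < 1" for j z
    by (rule norm_poisson_integral_less_1[OF m b _ that]) (use mean p in simp)
  have at_0: "poisson_integral (\<phi> j) 0 = p $ j" for j
    using poisson_integral_0[OF m] mean by simp
  have "\<exists>D. \<forall>j. (poisson_integral (\<phi> j) has_derivative D j) (at 0) \<and> cmod (D j (cis \<alpha>)) = MM (cmod (p $ j))"
  proof (intro choice allI)
    fix j
    obtain D where D: "(poisson_integral (\<phi> j) has_derivative D) (at 0)"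
      "\<And>\<alpha>. D (cis \<alpha>) = 2 * integral\<^sup>L circ (\<lambda>t. \<phi> j t * of_real (cos (t - \<alpha>)))"
      by (rule poisson_integral_has_derivative_0[OF m[of j] b[of j]]) (rule that)
    have "cmod (D (cis \<alpha>)) = MM (cmod (p $ j))"
      unfolding D(2) mean_cos using MM_nonneg by (simp add: norm_mult cu)
    with D(1) show "\<exists>D. (poisson_integral (\<phi> j) has_derivative D) (at 0) \<and> cmod (D (cis \<alpha>)) = MM (cmod (p $ j))"
      by blast
  qed
  then obtain D where D: "\<And>j. (poisson_integral (\<phi> j) has_derivative D j) (at 0)"
    and D_\<alpha>: "\<And>j. cmod (D j (cis \<alpha>)) = MM (cmod (p $ j))" by blast
  let ?F = "\<lambda>z. \<chi> j. poisson_integral (\<phi> j) z" and ?D = "\<lambda>h. \<chi> j. D j h"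
  let ?M = "sqrt (\<Sum>j\<in>UNIV. (MM (cmod (p $ j)))\<^sup>2)"
  have DF: "(?F has_derivative ?D) (at 0)"
    by (rule has_derivative_vec_lambda) (simp add: D)
  then have fd: "frechet_derivative ?F (at 0) = ?D" by (rule frechet_derivative_at[symmetric])
  have bl: "bounded_linear ?D" by (rule has_derivative_bounded_linear[OF DF])
  have le: "norm (?D (cis \<theta>)) \<le> ?M" for \<theta>
  proof -
    have "cmod (D j (cis \<theta>)) \<le> MM (cmod (p $ j))" for j
      using harmonic_derivative_le[OF harm _ D, of j \<theta>] less p(1)[of j] by (simp add: at_0 less_imp_le)
    then show ?thesis
      by (auto simp: norm_vec_def L2_set_def intro!: sum_mono power_mono)
  qed
  have "onorm ?D = ?M"
  proof (rule antisym)
    show "onorm ?D \<le> ?M" using onorm_attained_cis[OF bl] le by metis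
    have "?M = norm (?D (cis \<alpha>))" by (simp add: norm_vec_def L2_set_def D_\<alpha>)
    also have "\<dots> \<le> onorm ?D" using onorm[OF bl, of "cis \<alpha>"] by simp
    finally show "?M \<le> onorm ?D" .
  qed
  then show ?thesis
    unfolding extremal_at_def harmonic_polydisc_map_def \<phi>_def[symmetric] fd
    using harm less at_0 by (simp add: vec_eq_iff)
qed

text \<open>The quotient u * cnj c is purely imaginary of modulus 1, hence \<i> or - \<i>. This is
  the source of the signs \<sigma> in the theorem.\<close>

lemma orthogonal_unit_cases:
  assumes "cmod c = 1" "cmod u = 1" "Re (c * cnj u) = 0"
  obtains \<sigma> :: real where "\<sigma> \<in> {-1, 1}" "u = \<i> * of_real \<sigma> * c"
proof -
  define v where "v = u * cnj c"
  have "Re v = 0" using assms(3) by (simp add: v_def algebra_simps)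
  moreover have "cmod v = 1" using assms by (simp add: v_def norm_mult)
  ultimately have "\<bar>Im v\<bar> = 1" by (simp add: cmod_def)
  then have "Im v \<in> {-1, 1}" by auto
  moreover have "v = \<i> * of_real (Im v)" using \<open>Re v = 0\<close> by (simp add: complex_eq_iff)
  moreover have "u = v * c"
    using complex_norm_square[of c] assms(1) by (simp add: v_def mult.assoc mult.commute[of "cnj c"])
  ultimately show ?thesis by (metis that)
qed

theorem mainTheorem7:
  fixes p :: "complex ^ 'n" and r \<beta> :: "'n \<Rightarrow> real"
  assumes "\<forall>j. p $ j \<in> unit_disc"
    and "\<forall>j. p $ j \<noteq> 0 \<longrightarrow> 0 < r j \<and> r j < 1 \<and> p $ j = of_real (r j) * cis (\<beta> j)"
  shows "(\<forall>F. extremal_at p F \<longrightarrow>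
            (\<exists>\<alpha>. \<forall>j.
               (p $ j \<noteq> 0 \<longrightarrow> (\<exists>\<sigma>\<in>{-1, 1}. AE t in lborel.
                  has_radial_limit (\<lambda>z. F z $ j) t (bdry_nonzero (r j) (\<beta> j) \<sigma> \<alpha> t))) \<and>
               (p $ j = 0 \<longrightarrow> (\<exists>\<omega>\<in>sphere 0 1. AE t in lborel.
                  has_radial_limit (\<lambda>z. F z $ j) t (bdry_zero \<omega> \<alpha> t)))))
       \<and> (\<forall>\<alpha> (\<sigma> :: 'n \<Rightarrow> real) (\<omega> :: 'n \<Rightarrow> complex).
            (\<forall>j. \<sigma> j \<in> {-1, 1}) \<and> (\<forall>j. \<omega> j \<in> sphere 0 1) \<longrightarrow>
            extremal_at p (\<lambda>z. \<chi> j. poisson_integral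
              (if p $ j \<noteq> 0 then bdry_nonzero (r j) (\<beta> j) (\<sigma> j) \<alpha> else bdry_zero (\<omega> j) \<alpha>) z))
       \<and> (\<forall>F. extremal_at p F \<longrightarrow>
            (AE t in lborel. \<forall>j. \<exists>w\<in>sphere 0 1. has_radial_limit (\<lambda>z. F z $ j) t w))"
proof -
  \<comment> \<open>The default 1 is an arbitrary phase for a zero component, where
    \<open>lam0\<close> makes the term with \<open>c\<close> vanish.\<close>
  define c where "c j = (if p $ j = 0 then 1 else cis (\<beta> j))" for j
  have c: "cmod (c j) = 1" for j by (simp add: c_def)
  have disc: "p $ j \<in> unit_disc" for j using assms(1) by blast
  have r: "0 < r j" "r j = cmod (p $ j)" if "p $ j \<noteq> 0" for j
    using assms(2) that by (auto simp: norm_mult)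
  have pc: "p $ j = of_real (cmod (p $ j)) * c j" for j
    using assms(2) r by (cases "p $ j = 0") (auto simp: c_def)
  \<comment> \<open>Radial limit and modulus 1 are recorded together, so that the explicit form and
    the final claim on boundary values in the torus both follow from this.\<close>
  have necessary: "\<exists>\<alpha> u. \<forall>j. cmod (u j) = 1 \<and> lam0 (cmod (p $ j)) * Re (c j * cnj (u j)) = 0 \<and>
      (AE t in lborel. has_radial_limit (\<lambda>z. F z $ j) t (extremal_boundary (cmod (p $ j)) (c j) (u j) \<alpha> t) \<and>
        cmod (extremal_boundary (cmod (p $ j)) (c j) (u j) \<alpha> t) = 1)"
    if F: "extremal_at p F" for F
  proof -
    obtain \<alpha> D where D: "\<And>j. ((\<lambda>z. F z $ j) has_derivative D j) (at 0)"
      "\<And>j. cmod (D j (cis \<alpha>)) = MM (cmod (p $ j))"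
      by (rule extremal_component_directions[OF disc F]) blast
    have "\<exists>u. cmod u = 1 \<and> lam0 (cmod (p $ j)) * Re (c j * cnj u) = 0 \<and>
      (AE t in lborel. has_radial_limit (\<lambda>z. F z $ j) t (extremal_boundary (cmod (p $ j)) (c j) u \<alpha> t) \<and>
        cmod (extremal_boundary (cmod (p $ j)) (c j) u \<alpha> t) = 1)" for j
    proof -
      have F': "harmonic_on (\<lambda>z. F z $ j) unit_disc" "\<And>z. z \<in> unit_disc \<Longrightarrow> cmod (F z $ j) \<le> 1"
        "F 0 $ j = of_real (cmod (p $ j)) * c j"
        using F pc[of j] by (auto simp: extremal_at_def harmonic_polydisc_map_def less_imp_le)
      have "cmod (p $ j) < 1" using disc[of j] by simp
      then obtain u where u: "cmod u = 1" "lam0 (cmod (p $ j)) * Re (c j * cnj u) = 0"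
        and lim: "\<And>t. cos (t - \<alpha>) \<noteq> 0 \<Longrightarrow>
          has_radial_limit (\<lambda>z. F z $ j) t (extremal_boundary (cmod (p $ j)) (c j) u \<alpha> t)"
        using harmonic_derivative_eq_imp[OF F'(1,2) D(1) F'(3) c norm_ge_zero _ D(2)] by blast
      have "AE t in lborel. has_radial_limit (\<lambda>z. F z $ j) t (extremal_boundary (cmod (p $ j)) (c j) u \<alpha> t) \<and>
        cmod (extremal_boundary (cmod (p $ j)) (c j) u \<alpha> t) = 1"
        using AE_cos_nonzero[of \<alpha>] by eventually_elim (use lim norm_extremal_boundary[OF c u] in blast)
      with u show ?thesis by blast
    qed
    then show ?thesis by (intro exI[of _ \<alpha>] choice allI)
  qed
  show ?thesis
  proof (intro conjI allI impI)
    fix F assume F: "extremal_at p F"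
    obtain \<alpha> u where u: "\<And>j. cmod (u j) = 1" "\<And>j. lam0 (cmod (p $ j)) * Re (c j * cnj (u j)) = 0"
      and ae: "\<And>j. AE t in lborel. has_radial_limit (\<lambda>z. F z $ j) t (extremal_boundary (cmod (p $ j)) (c j) (u j) \<alpha> t) \<and>
        cmod (extremal_boundary (cmod (p $ j)) (c j) (u j) \<alpha> t) = 1"
      using necessary[OF F] by blast
    show "AE t in lborel. \<forall>j. \<exists>w\<in>sphere 0 1. has_radial_limit (\<lambda>z. F z $ j) t w"
    proof -
      have "AE t in lborel. \<exists>w\<in>sphere 0 1. has_radial_limit (\<lambda>z. F z $ j) t w" for j
        using ae[of j] by eventually_elim auto
      then show ?thesis by (intro eventually_all_finite) auto
    qed
    show "\<exists>\<alpha>. \<forall>j.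
               (p $ j \<noteq> 0 \<longrightarrow> (\<exists>\<sigma>\<in>{-1, 1}. AE t in lborel.
                  has_radial_limit (\<lambda>z. F z $ j) t (bdry_nonzero (r j) (\<beta> j) \<sigma> \<alpha> t))) \<and>
               (p $ j = 0 \<longrightarrow> (\<exists>\<omega>\<in>sphere 0 1. AE t in lborel.
                  has_radial_limit (\<lambda>z. F z $ j) t (bdry_zero \<omega> \<alpha> t)))"
    proof (intro exI[of _ \<alpha>] allI conjI impI)
      fix j assume pj: "p $ j \<noteq> 0"
      \<comment> \<open>Positivity of \<lambda> turns the product condition into orthogonality of
        \<open>u j\<close> and \<open>c j\<close>. For p_j = 0 it imposes nothing, and
        \<open>u j\<close> itself is the free factor \<omega>.\<close>
      have "lam0 (cmod (p $ j)) > 0"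
        using lam_pos_integral[of "cmod (p $ j)"] pj disc[of j] by (simp add: lam0_def)
      with u(2)[of j] have "Re (c j * cnj (u j)) = 0" by simp
      then obtain \<sigma> :: real where \<sigma>: "\<sigma> \<in> {-1, 1}" "u j = \<i> * of_real \<sigma> * c j"
        by (rule orthogonal_unit_cases[OF c u(1)])
      have "bdry_nonzero (r j) (\<beta> j) \<sigma> \<alpha> = extremal_boundary (cmod (p $ j)) (c j) (u j) \<alpha>"
        using bdry_nonzero_eq[OF r(1)[OF pj] \<sigma>(1)] pj by (simp add: \<sigma>(2) c_def r(2)[OF pj])
      then have "AE t in lborel. has_radial_limit (\<lambda>z. F z $ j) t (bdry_nonzero (r j) (\<beta> j) \<sigma> \<alpha> t)"
        using ae[of j] by simp
      with \<sigma>(1) show "\<exists>\<sigma>\<in>{-1, 1}. AE t in lborel.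
          has_radial_limit (\<lambda>z. F z $ j) t (bdry_nonzero (r j) (\<beta> j) \<sigma> \<alpha> t)" by blast
    next
      fix j assume pj: "p $ j = 0"
      have "bdry_zero (u j) \<alpha> = extremal_boundary (cmod (p $ j)) (c j) (u j) \<alpha>"
        using bdry_zero_eq[OF u(1)] pj by simp
      then have "AE t in lborel. has_radial_limit (\<lambda>z. F z $ j) t (bdry_zero (u j) \<alpha> t)"
        using ae[of j] by simp
      with u(1)[of j] show "\<exists>\<omega>\<in>sphere 0 1. AE t in lborel.
          has_radial_limit (\<lambda>z. F z $ j) t (bdry_zero \<omega> \<alpha> t)" by auto
    qed
  next
    fix \<alpha> :: real and \<sigma> :: "'n \<Rightarrow> real" and \<omega> :: "'n \<Rightarrow> complex"
    assume *: "(\<forall>j. \<sigma> j \<in> {-1, 1}) \<and> (\<forall>j. \<omega> j \<in> sphere 0 1)"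
    define u where "u j = (if p $ j = 0 then \<omega> j else \<i> * of_real (\<sigma> j) * cis (\<beta> j))" for j
    have bdry: "(if p $ j \<noteq> 0 then bdry_nonzero (r j) (\<beta> j) (\<sigma> j) \<alpha> else bdry_zero (\<omega> j) \<alpha>) =
        extremal_boundary (cmod (p $ j)) (c j) (u j) \<alpha>" for j
    proof (cases "p $ j = 0")
      case True
      then show ?thesis using bdry_zero_eq[of "\<omega> j" \<alpha> "c j"] * by (simp add: u_def)
    next
      case False
      then show ?thesis using bdry_nonzero_eq[OF r(1), of j "\<sigma> j" "\<beta> j" \<alpha>] * by (simp add: u_def c_def r(2))
    qed
    have \<sigma>: "\<bar>\<sigma> j\<bar> = 1" for j
    proof -
      have "\<sigma> j \<in> {-1, 1}" using * by blast
      then show ?thesis by auto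
    qed
    have u: "cmod (u j) = 1" "lam0 (cmod (p $ j)) * Re (c j * cnj (u j)) = 0" for j
    proof -
      show "cmod (u j) = 1" using * \<sigma> by (simp add: u_def norm_mult)
      show "lam0 (cmod (p $ j)) * Re (c j * cnj (u j)) = 0"
        by (simp add: u_def c_def lam0_def)
    qed
    show "extremal_at p (\<lambda>z. \<chi> j. poisson_integral
        (if p $ j \<noteq> 0 then bdry_nonzero (r j) (\<beta> j) (\<sigma> j) \<alpha> else bdry_zero (\<omega> j) \<alpha>) z)"
      unfolding bdry
      using extremal_at_poisson_extremal_boundary[of p "\<chi> j. c j" "\<chi> j. u j" \<alpha>] disc pc c u by simp
  qed
qed

end
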